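(* Let $H$ be a complex Hilbert space and let $T\in B(H)$ be such that $T^n\to0$ in the weak operator topology as $n\to\infty$ and $\sigma(T)\supset\mathbb T$. Let $\tilde C$ be a strict contraction on a separable Hilbert space, i.e. a bounded linear operator with $\|\tilde C\|<1$. Then for every $\varepsilon>0$ there exist a (closed) subspace $L\subset H$ and an operator $C\in B(L)$ unitarily equivalent to $\tilde C$ such that $$\lim_{n\to\infty}\|(T^n)_L-C^n\|=0\qquad\text{and}\qquad\sup_{n\ge1}\|(T^n)_L-C^n\|\le\varepsilon.$$
   Context: $B(H)$ is the algebra of bounded linear operators on $H$, $\sigma(T)$ is the spectrum of $T$, and $\mathbb T=\{\lambda\in\mathbb C:|\lambda|=1\}$. For a closed subspace $L\subset H$ and $S\in B(H)$, the compression $S_L\in B(L)$ is $S_L=J_L^*SJ_L$, where $J_L:L\to H$ is the inclusion (equivalently $S_Lx=P_LSx$ for $x\in L$, with $P_L$ the orthogonal projection of $H$ onto $L$). *)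

theory Defs
  imports "HOL-Analysis.Analysis"
begin

section \<open>Complex Hilbert spaces\<close>

class complex_vector = real_vector +
  fixes scaleC :: "complex \<Rightarrow> 'a \<Rightarrow> 'a"  (infixr \<open>*\<^sub>C\<close> 75)
  assumes scaleC_add_right: "c *\<^sub>C (x + y) = c *\<^sub>C x + c *\<^sub>C y"
    and scaleC_add_left: "(c + d) *\<^sub>C x = c *\<^sub>C x + d *\<^sub>C x"
    and scaleC_scaleC: "c *\<^sub>C (d *\<^sub>C x) = (c * d) *\<^sub>C x"
    and scaleC_one: "1 *\<^sub>C x = x"
    and scaleR_scaleC: "r *\<^sub>R x = complex_of_real r *\<^sub>C x"

text \<open>The inner product is linear in the first argument and conjugate-linear in the second.
  Definiteness is a consequence of the last axiom, because \<open>norm\<close> is a norm.\<close>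

class complex_inner = complex_vector + real_normed_vector +
  fixes cinner :: "'a \<Rightarrow> 'a \<Rightarrow> complex"
  assumes cinner_commute: "cinner x y = cnj (cinner y x)"
    and cinner_add_left: "cinner (x + y) z = cinner x z + cinner y z"
    and cinner_scaleC_left: "cinner (c *\<^sub>C x) y = c * cinner x y"
    and cinner_self_nonneg: "0 \<le> Re (cinner x x)"
    and norm_eq_sqrt_cinner: "norm x = sqrt (Re (cinner x x))"

class chilbert_space = complex_inner + complete_space

instantiation complex :: chilbert_space
begin

definition scaleC_complex :: "complex \<Rightarrow> complex \<Rightarrow> complex"
  where "scaleC_complex c x = c * x"

definition cinner_complex :: "complex \<Rightarrow> complex \<Rightarrow> complex"
  where "cinner_complex x y = x * cnj y"

instance
proof
  fix x y z c d :: complex and r :: real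
  show "c *\<^sub>C (x + y) = c *\<^sub>C x + c *\<^sub>C y" "(c + d) *\<^sub>C x = c *\<^sub>C x + d *\<^sub>C x"
    "c *\<^sub>C (d *\<^sub>C x) = (c * d) *\<^sub>C x" "1 *\<^sub>C x = x"
    by (simp_all add: scaleC_complex_def algebra_simps)
  show "r *\<^sub>R x = complex_of_real r *\<^sub>C x"
    by (simp add: scaleC_complex_def scaleR_conv_of_real)
  show "cinner x y = cnj (cinner y x)" "cinner (x + y) z = cinner x z + cinner y z"
    "cinner (c *\<^sub>C x) y = c * cinner x y"
    by (simp_all add: cinner_complex_def scaleC_complex_def algebra_simps)
  show "0 \<le> Re (cinner x x)" "norm x = sqrt (Re (cinner x x))"
    by (simp_all add: cinner_complex_def cmod_def power2_eq_square)
qed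

end


section \<open>Bounded operators\<close>

text \<open>The operator norm of a bounded operator is the library's \<^const>\<open>onorm\<close>.\<close>

definition bounded_clinear :: "('a::complex_inner \<Rightarrow> 'b::complex_inner) \<Rightarrow> bool"
  where "bounded_clinear T \<longleftrightarrow>
    bounded_linear T \<and> (\<forall>c x. T (c *\<^sub>C x) = c *\<^sub>C T x)"

definition op_spectrum :: "('a::complex_inner \<Rightarrow> 'a) \<Rightarrow> complex set"
  where "op_spectrum T = {z. \<not> (\<exists>S. bounded_clinear S \<and>
    (\<forall>x. S (z *\<^sub>C x - T x) = x) \<and> (\<forall>x. z *\<^sub>C S x - T (S x) = x))}"

definition wot_tendsto ::
    "('i \<Rightarrow> 'a::complex_inner \<Rightarrow> 'a) \<Rightarrow> ('a \<Rightarrow> 'a) \<Rightarrow> 'i filter \<Rightarrow> bool"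
  where "wot_tendsto A S F \<longleftrightarrow>
    (\<forall>x y. ((\<lambda>i. cinner (A i x) y) \<longlongrightarrow> cinner (S x) y) F)"


section \<open>Closed subspaces and operators on them\<close>

definition closed_csubspace :: "'a::complex_inner set \<Rightarrow> bool"
  where "closed_csubspace L \<longleftrightarrow> closed L \<and> 0 \<in> L \<and>
    (\<forall>x\<in>L. \<forall>y\<in>L. x + y \<in> L) \<and> (\<forall>c. \<forall>x\<in>L. c *\<^sub>C x \<in> L)"

text \<open>An element of \<open>B(L)\<close> is represented by a function on the ambient space;
  its values outside \<open>L\<close> are irrelevant, and everything below only looks at its values on \<open>L\<close>.\<close>

definition bounded_clinear_on :: "'a::complex_inner set \<Rightarrow> ('a \<Rightarrow> 'a) \<Rightarrow> bool"
  where "bounded_clinear_on L C \<longleftrightarrow>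
    (\<forall>x\<in>L. C x \<in> L) \<and>
    (\<forall>x\<in>L. \<forall>y\<in>L. C (x + y) = C x + C y) \<and>
    (\<forall>c. \<forall>x\<in>L. C (c *\<^sub>C x) = c *\<^sub>C C x) \<and>
    (\<exists>K. \<forall>x\<in>L. norm (C x) \<le> norm x * K)"

text \<open>The norm of \<open>B(L)\<close>, in the same form as \<^const>\<open>onorm\<close> (recall \<open>0 / 0 = 0\<close>,
  which gives norm 0 on the zero subspace).\<close>

definition onorm_on :: "'a::complex_inner set \<Rightarrow> ('a \<Rightarrow> 'a) \<Rightarrow> real"
  where "onorm_on L C = (SUP x\<in>L. norm (C x) / norm x)"

text \<open>The unique point of \<open>L\<close> whose difference from \<open>x\<close> is orthogonal to \<open>L\<close>; it exists
  when \<open>L\<close> is a closed subspace of a Hilbert space.\<close>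

definition orth_proj :: "'a::complex_inner set \<Rightarrow> 'a \<Rightarrow> 'a"
  where "orth_proj L x = (THE y. y \<in> L \<and> (\<forall>z\<in>L. cinner (x - y) z = 0))"

definition compression :: "'a::complex_inner set \<Rightarrow> ('a \<Rightarrow> 'a) \<Rightarrow> 'a \<Rightarrow> 'a"
  where "compression L S x = orth_proj L (S x)"

definition unitary_onto :: "('b::complex_inner \<Rightarrow> 'a::complex_inner) \<Rightarrow> 'a set \<Rightarrow> bool"
  where "unitary_onto U L \<longleftrightarrow>
    bounded_clinear U \<and> (\<forall>x y. cinner (U x) (U y) = cinner x y) \<and> range U = L"

text \<open>\<open>C\<close> on \<open>L\<close> is unitarily equivalent to \<open>D\<close> on the whole space \<open>'b\<close>.\<close>

definition unitarily_equivalent_on ::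
    "'a::complex_inner set \<Rightarrow> ('a \<Rightarrow> 'a) \<Rightarrow> ('b::complex_inner \<Rightarrow> 'b) \<Rightarrow> bool"
  where "unitarily_equivalent_on L C D \<longleftrightarrow>
    (\<exists>U. unitary_onto U L \<and> (\<forall>x. C (U x) = U (D x)))"

end

theory Submission
  imports Defs
begin

text \<open>
  Let \<open>C\<close> be the given strict contraction, with norm \<open>q\<close>. Its defect form
  \<open>Q x y = \<langle>x, y\<rangle> - \<langle>C x, C y\<rangle>\<close> is positive, and on a separable space it can be written as
  \<open>Q x y = \<Sum>\<^sub>m \<phi>\<^sub>m(x) cnj (\<phi>\<^sub>m(y))\<close> with linear functionals \<open>\<phi>\<^sub>m\<close> (\<open>pos_form_eq_suminf\<close>). Telescoping gives
  \<open>\<langle>C\<^sup>n x, y\<rangle> = \<Sum>\<^sub>m \<Sum>\<^bsub>l<N-n\<^esub> \<phi>\<^sub>m(C\<^bsup>l+n\<^esup> x) cnj (\<phi>\<^sub>m(C\<^sup>l y))\<close> up to the term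
  \<open>\<langle>C\<^sup>N x, C\<^bsup>N-n\<^esup> y\<rangle>\<close>, whose size is at most \<open>q\<^sup>N\<close>. This is the isometric dilation of \<open>C\<close>, in
  which \<open>C\<close> becomes a backward shift, truncated at level \<open>N\<close>. Suppose that \<open>H\<close> contains
  orthonormal vectors \<open>w\<^bsub>m,k\<^esub>\<close>, \<open>k \<le> N\<close>, with \<open>\<langle>T\<^sup>n w\<^bsub>m,k\<^esub>, w\<^bsub>m',l\<^esub>\<rangle>\<close> equal to 1 if \<open>m = m'\<close> and
  \<open>k = l + n\<close>, and to 0 otherwise. Then \<open>V x = \<Sum>\<^sub>m \<Sum>\<^sub>k \<phi>\<^sub>m(C\<^sup>k x) w\<^bsub>m,k\<^esub>\<close>, made isometric by letting level
  \<open>N\<close> carry \<open>C\<^sup>N x\<close> in full, satisfies \<open>\<langle>T\<^sup>n V x, V y\<rangle> = \<langle>C\<^sup>n x, y\<rangle>\<close> up to \<open>O(q\<^sup>N)\<close> for \<open>n \<le> N\<close>, while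
  both \<open>C\<^sup>n\<close> and the shift are negligible for \<open>n > N\<close>. The subspace sought is the range of \<open>V\<close>.

  The vectors \<open>w\<^bsub>m,k\<^esub>\<close> exist up to small errors. The powers of \<open>T\<close> are bounded by the uniform boundedness
  principle, so points of the circle are approximate eigenvalues, and as they are not eigenvalues, the
  approximate eigenvectors can be chosen orthogonal to any finite set. The discrete Fourier transform
  of approximate eigenvectors at roots of unity is a block of vectors on which \<open>T\<close> acts as a shift,
  but only up to some time \<open>R\<close> (\<open>shift_block_finite_time\<close>). From some later time on all products are
  close to 0, as they should be. There is no control in between, but averaging
  many blocks whose uncontrolled periods are disjoint makes that damage small
  (\<open>shift_block_sum\<close>). The result is a sequence of blocks with errors that are small for all \<open>n\<close>
  at once and are dominated by a summable double series in the indices (\<open>shift_model\<close>). Each single error tends to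
  0 as \<open>n\<close> tends to infinity because \<open>T\<^sup>n\<close> tends to 0 weakly, hence so does their sum, which bounds
  the operator norm: this is how weak convergence of the powers yields norm convergence.
\<close>

section \<open>Inner products and positive forms\<close>

lemma cinner_self: "cinner x x = complex_of_real ((norm x)\<^sup>2)" for x :: "'a::complex_inner"
proof -
  have "Im (cinner x x) = 0"
    by (metis cinner_commute cnj.simps(2) neg_equal_zero)
  moreover have "Re (cinner x x) = (norm x)\<^sup>2"
    using norm_eq_sqrt_cinner[of x] cinner_self_nonneg[of x] by simp
  ultimately show ?thesis
    by (simp add: complex_eq_iff)
qed

lemma norm_eq_sqrt_if_cinner_eq: "norm x = sqrt r" if "cinner x x = complex_of_real r"
  for x :: "'a::complex_inner"
  unfolding norm_eq_sqrt_cinner that by simp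

text \<open>Positive semidefinite sesquilinear forms are treated in general, because the Cholesky
  procedure below runs through degenerate forms even when it starts from the inner product.\<close>

definition pos_form :: "('b::complex_vector \<Rightarrow> 'b \<Rightarrow> complex) \<Rightarrow> bool"
  where "pos_form Q \<longleftrightarrow>
    (\<forall>x y z. Q (x + y) z = Q x z + Q y z) \<and> (\<forall>c x y. Q (c *\<^sub>C x) y = c * Q x y) \<and>
    (\<forall>x y. Q x y = cnj (Q y x)) \<and> (\<forall>x. 0 \<le> Re (Q x x))"

lemma pos_form_cinner: "pos_form (cinner :: 'a::complex_inner \<Rightarrow> 'a \<Rightarrow> complex)"
  unfolding pos_form_def
  using cinner_commute cinner_add_left cinner_scaleC_left cinner_self_nonneg by blast

context
  fixes Q :: "'b::complex_vector \<Rightarrow> 'b \<Rightarrow> complex"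
  assumes Q: "pos_form Q"
begin

lemma pos_form_add_left: "Q (x + y) z = Q x z + Q y z"
  and pos_form_scaleC_left: "Q (c *\<^sub>C x) y = c * Q x y"
  and pos_form_commute: "Q x y = cnj (Q y x)"
  and pos_form_nonneg: "0 \<le> Re (Q x x)"
  using Q unfolding pos_form_def by blast+

lemma pos_form_add_right: "Q x (y + z) = Q x y + Q x z"
  by (metis complex_cnj_add pos_form_add_left pos_form_commute)

lemma pos_form_scaleC_right: "Q x (c *\<^sub>C y) = cnj c * Q x y"
  by (metis complex_cnj_mult pos_form_commute pos_form_scaleC_left)

lemma pos_form_self_real: "Q x x = complex_of_real (Re (Q x x))"
  by (metis Reals_cnj_iff of_real_Re pos_form_commute)

lemma pos_form_expand:
  "Re (Q (x + c *\<^sub>C y) (x + c *\<^sub>C y)) =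
    Re (Q x x) + 2 * Re (cnj c * Q x y) + (cmod c)\<^sup>2 * Re (Q y y)"
proof -
  have "Re (c * Q y x) = Re (cnj c * Q x y)"
    by (metis complex_cnj_cnj complex_cnj_mult cnj.simps(1) pos_form_commute)
  moreover have "Re (c * (cnj c * Q y y)) = (cmod c)\<^sup>2 * Re (Q y y)"
    by (metis complex_norm_square mult.assoc Re_complex_of_real pos_form_self_real of_real_mult)
  moreover have "Q (x + c *\<^sub>C y) (x + c *\<^sub>C y) = Q x x + cnj c * Q x y + c * Q y x + c * (cnj c * Q y y)"
    by (simp add: pos_form_add_left pos_form_add_right pos_form_scaleC_left pos_form_scaleC_right
        algebra_simps)
  ultimately show ?thesis
    by (simp only: plus_complex.sel mult_2)
qed

lemma pos_form_Cauchy_Schwarz: "(cmod (Q x y))\<^sup>2 \<le> Re (Q x x) * Re (Q y y)"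
proof -
  define p where "p = Q x y"
  have ineq: "0 \<le> Re (Q x x) - 2 * t * (cmod p)\<^sup>2 + t\<^sup>2 * (cmod p)\<^sup>2 * Re (Q y y)" for t :: real
  proof -
    define c where "c = - (of_real t * p)"
    have "Re (cnj c * Q x y) = - (t * (cmod p)\<^sup>2)"
      unfolding c_def p_def[symmetric] cmod_power2
      by (simp add: power2_eq_square algebra_simps)
    moreover have "(cmod c)\<^sup>2 = t\<^sup>2 * (cmod p)\<^sup>2"
      by (simp add: c_def norm_mult power_mult_distrib)
    ultimately show ?thesis
      using pos_form_expand[of x c y] pos_form_nonneg[of "x + c *\<^sub>C y"] by simp
  qed
  show ?thesis
  proof (cases "Re (Q y y) = 0")
    case True
    have "p = 0"
    proof (rule ccontr)
      assume "p \<noteq> 0"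
      then have "(cmod p)\<^sup>2 > 0" by simp
      \<comment> \<open>the quadratic has degenerated to an affine function of \<open>t\<close>; here it would be negative\<close>
      then show False
        using ineq[of "(Re (Q x x) + 1) / (cmod p)\<^sup>2"] True pos_form_nonneg[of x] by simp
    qed
    then show ?thesis using True p_def by simp
  next
    case False
    then have b: "Re (Q y y) > 0"
      using pos_form_nonneg[of y] by simp
    have "0 \<le> Re (Q x x) - (cmod p)\<^sup>2 / Re (Q y y)"
      using ineq[of "1 / Re (Q y y)"] b by (simp add: power2_eq_square)
    then show ?thesis
      using b by (simp add: p_def field_simps)
  qed
qed

lemma pos_form_eq_0:
  assumes "Re (Q y y) = 0"
  shows "Q x y = 0" "Q y x = 0"
proof -
  show "Q x y = 0"
    using pos_form_Cauchy_Schwarz[of x y] assms by simp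
  then show "Q y x = 0"
    by (metis complex_cnj_zero pos_form_commute)
qed

end

lemma cinner_add_right: "cinner x (y + z) = cinner x y + cinner x z"
  and cinner_scaleC_right: "cinner x (c *\<^sub>C y) = cnj c * cinner x y"
  for x y z :: "'a::complex_inner"
  using pos_form_add_right[OF pos_form_cinner] pos_form_scaleC_right[OF pos_form_cinner] by blast+

lemma norm_cinner_le: "cmod (cinner x y) \<le> norm x * norm y" for x y :: "'a::complex_inner"
proof -
  have "(cmod (cinner x y))\<^sup>2 \<le> (norm x * norm y)\<^sup>2"
    using pos_form_Cauchy_Schwarz[OF pos_form_cinner, of x y]
    by (simp add: cinner_self power_mult_distrib flip: of_real_power)
  then show ?thesis
    by (rule power2_le_imp_le) simp
qed

lemma cinner_scaleR_left: "cinner (r *\<^sub>R x) y = r *\<^sub>R cinner x y"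
  and cinner_scaleR_right: "cinner x (r *\<^sub>R y) = r *\<^sub>R cinner x y"
  for x y :: "'a::complex_inner"
  by (simp_all only: scaleR_scaleC[of r x] scaleR_scaleC[of r y] cinner_scaleC_left cinner_scaleC_right
      scaleR_conv_of_real complex_cnj_complex_of_real)

interpretation cinner: bounded_bilinear "cinner :: 'a::complex_inner \<Rightarrow> 'a \<Rightarrow> complex"
  by unfold_locales
    (auto simp: cinner_add_left cinner_add_right cinner_scaleR_left cinner_scaleR_right
      intro!: exI[of _ 1] norm_cinner_le)

lemma norm_scaleC: "norm (c *\<^sub>C x) = cmod c * norm x" for x :: "'a::complex_inner"
proof -
  have "complex_of_real ((norm (c *\<^sub>C x))\<^sup>2) = (c * cnj c) * complex_of_real ((norm x)\<^sup>2)"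
    by (simp only: cinner_self[symmetric] cinner_scaleC_left cinner_scaleC_right mult.assoc mult.left_commute)
  also have "\<dots> = complex_of_real ((cmod c * norm x)\<^sup>2)"
    by (simp add: power_mult_distrib flip: complex_norm_square)
  finally have "(norm (c *\<^sub>C x))\<^sup>2 = (cmod c * norm x)\<^sup>2"
    using of_real_eq_iff by blast
  then show ?thesis
    by (rule power2_eq_imp_eq) auto
qed

interpretation scaleC: bounded_bilinear "scaleC :: complex \<Rightarrow> 'a::complex_inner \<Rightarrow> 'a"
proof
  fix r :: real and a :: complex and b :: 'a
  show "(r *\<^sub>R a) *\<^sub>C b = r *\<^sub>R a *\<^sub>C b" "a *\<^sub>C r *\<^sub>R b = r *\<^sub>R a *\<^sub>C b"
    by (simp_all only: scaleR_scaleC[of r b] scaleR_scaleC[of r "a *\<^sub>C b"] scaleC_scaleC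
        scaleR_conv_of_real mult.commute)
qed (auto simp: scaleC_add_left scaleC_add_right norm_scaleC intro!: exI[of _ 1])

lemma norm_add_sq:
  "(norm (x + y))\<^sup>2 = (norm x)\<^sup>2 + 2 * Re (cinner x y) + (norm y)\<^sup>2" for x y :: "'a::complex_inner"
  using pos_form_expand[OF pos_form_cinner, of x 1 y]
  by (simp add: scaleC_one cinner_self flip: of_real_power)

lemma norm_diff_sq:
  "(norm (x - y))\<^sup>2 = (norm x)\<^sup>2 - 2 * Re (cinner x y) + (norm y)\<^sup>2" for x y :: "'a::complex_inner"
  using norm_add_sq[of x "- y"] by (simp add: cinner.minus_right)

instance chilbert_space \<subseteq> banach ..

lemma bounded_clinear_pow: "bounded_clinear T \<Longrightarrow> bounded_clinear (T ^^ n)"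
  for T :: "'a::complex_inner \<Rightarrow> 'a"
proof (induction n)
  case 0
  have "bounded_linear (\<lambda>x::'a. x)" by (rule bounded_linear_ident)
  then show ?case by (simp add: bounded_clinear_def id_def)
next
  case (Suc n)
  then show ?case
    by (auto simp: bounded_clinear_def o_def intro: bounded_linear_compose)
qed

lemma bounded_clinear_scaleC: "bounded_clinear T \<Longrightarrow> T (c *\<^sub>C x) = c *\<^sub>C T x"
  and bounded_clinear_bounded_linear: "bounded_clinear T \<Longrightarrow> bounded_linear T"
  by (auto simp: bounded_clinear_def)

lemma cinner_orthonormal_sums:
  fixes u :: "'i \<Rightarrow> 'a::complex_inner"
  assumes orth: "\<And>i j. i \<in> S \<Longrightarrow> j \<in> S \<Longrightarrow> cinner (u i) (u j) = (if i = j then 1 else 0)"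
    and "finite S"
  shows "cinner (\<Sum>i\<in>S. a i *\<^sub>C u i) (\<Sum>i\<in>S. b i *\<^sub>C u i) = (\<Sum>i\<in>S. a i * cnj (b i))"
proof -
  have "cinner (\<Sum>i\<in>S. a i *\<^sub>C u i) (\<Sum>i\<in>S. b i *\<^sub>C u i) =
      (\<Sum>i\<in>S. \<Sum>j\<in>S. a i * (cnj (b j) * cinner (u i) (u j)))"
    unfolding cinner.sum_left[of _ S] unfolding cinner.sum_right[of _ _ S]
    by (simp only: cinner_scaleC_left cinner_scaleC_right) (simp only: mult.left_commute)
  also have "\<dots> = (\<Sum>i\<in>S. \<Sum>j\<in>S. if i = j then a i * cnj (b i) else 0)"
    by (intro sum.cong refl) (simp add: orth)
  also have "\<dots> = (\<Sum>i\<in>S. a i * cnj (b i))"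
    using \<open>finite S\<close> by simp
  finally show ?thesis .
qed

lemma cinner_sum_blocks:
  fixes w :: "nat \<Rightarrow> nat \<Rightarrow> 'a::complex_inner"
  assumes orth: "\<And>m m' k l. k < K \<Longrightarrow> l < K \<Longrightarrow>
      cinner (w m k) (w m' l) = (if m = m' \<and> k = l then 1 else 0)"
    and "finite S"
  shows "cinner (\<Sum>m\<in>S. \<Sum>k<K. a m k *\<^sub>C w m k) (\<Sum>m\<in>S. \<Sum>k<K. b m k *\<^sub>C w m k) =
    (\<Sum>m\<in>S. \<Sum>k<K. a m k * cnj (b m k))"
  unfolding sum.cartesian_product split_beta
  by (rule cinner_orthonormal_sums) (auto simp: orth prod_eq_iff \<open>finite S\<close>)

text \<open>A lower bound pulls the Cauchy property of the image back to the sequence. It is assumed only on the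
  sequence itself, so that the lemma also applies to maps bounded below on a subspace.\<close>

lemma convergent_if_bounded_below:
  fixes x :: "nat \<Rightarrow> 'a::banach" and A :: "'a \<Rightarrow> 'c::real_normed_vector"
  assumes "\<delta> > 0" and below: "\<And>k l. \<delta> * norm (x k - x l) \<le> norm (A (x k) - A (x l))"
    and lim: "(\<lambda>k. A (x k)) \<longlonglongrightarrow> y"
  shows "convergent x"
proof -
  have "Cauchy x"
  proof (rule metric_CauchyI)
    fix e :: real assume "e > 0"
    then have "\<delta> * e > 0" using \<open>\<delta> > 0\<close> by simp
    then obtain K where K: "\<And>k l. k \<ge> K \<Longrightarrow> l \<ge> K \<Longrightarrow> dist (A (x k)) (A (x l)) < \<delta> * e"
      using LIMSEQ_imp_Cauchy[OF lim] unfolding Cauchy_def by blast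
    have "dist (x k) (x l) < e" if "k \<ge> K" "l \<ge> K" for k l
    proof -
      have "\<delta> * norm (x k - x l) < \<delta> * e"
        using below[of k l] K[OF that] by (simp add: dist_norm)
      then show ?thesis using \<open>\<delta> > 0\<close> by (simp add: dist_norm)
    qed
    then show "\<exists>K. \<forall>k\<ge>K. \<forall>l\<ge>K. dist (x k) (x l) < e" by blast
  qed
  then show ?thesis by (rule Cauchy_convergent)
qed

section \<open>Cholesky decomposition of positive forms\<close>

text \<open>One elimination step. When \<open>Q a a = 0\<close> the quotient is 0 and nothing is subtracted, which is
  right because then \<open>Q a\<close> vanishes identically.\<close>

definition schur_complement :: "('b \<Rightarrow> 'b \<Rightarrow> complex) \<Rightarrow> 'b \<Rightarrow> 'b \<Rightarrow> 'b \<Rightarrow> complex"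
  where "schur_complement Q a x y = Q x y - Q x a * Q a y / Q a a"

lemma
  fixes Q :: "'b::complex_vector \<Rightarrow> 'b \<Rightarrow> complex"
  assumes Q: "pos_form Q"
  shows pos_form_schur_complement: "pos_form (schur_complement Q a)"
    and schur_complement_le: "Re (schur_complement Q a x x) \<le> Re (Q x x)"
    and schur_complement_self: "schur_complement Q a a a = 0"
proof -
  have diag: "Re (schur_complement Q a x x) = Re (Q x x) - (cmod (Q x a))\<^sup>2 / Re (Q a a)" for x
  proof -
    have "Q x a * Q a x / Q a a = Q x a * cnj (Q x a) / complex_of_real (Re (Q a a))"
      using pos_form_commute[OF Q, of a x] pos_form_self_real[OF Q, of a] by simp
    also have "\<dots> = complex_of_real ((cmod (Q x a))\<^sup>2 / Re (Q a a))"
      by (simp add: complex_norm_square[symmetric])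
    finally show ?thesis unfolding schur_complement_def by simp
  qed
  show "Re (schur_complement Q a x x) \<le> Re (Q x x)"
    unfolding diag using pos_form_nonneg[OF Q, of a] by simp
  show "schur_complement Q a a a = 0"
    by (simp add: schur_complement_def)
  show "pos_form (schur_complement Q a)"
    unfolding pos_form_def
  proof (intro conjI allI)
    fix x y z :: 'b and c
    show "schur_complement Q a (x + y) z = schur_complement Q a x z + schur_complement Q a y z"
      by (simp add: schur_complement_def pos_form_add_left[OF Q] algebra_simps add_divide_distrib)
    show "schur_complement Q a (c *\<^sub>C x) y = c * schur_complement Q a x y"
      by (simp add: schur_complement_def pos_form_scaleC_left[OF Q] algebra_simps)
    have "cnj (Q y a) = Q a y" "cnj (Q a x) = Q x a" "cnj (Q a a) = Q a a" "cnj (Q y x) = Q x y"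
      using pos_form_commute[OF Q] by metis+
    then show "schur_complement Q a x y = cnj (schur_complement Q a y x)"
      by (simp add: schur_complement_def mult.commute)
    show "0 \<le> Re (schur_complement Q a x x)"
    proof (cases "Re (Q a a) = 0")
      case True
      then show ?thesis using pos_form_nonneg[OF Q] by (simp add: diag)
    next
      case False
      then have "Re (Q a a) > 0" using pos_form_nonneg[OF Q, of a] by simp
      then show ?thesis
        using pos_form_Cauchy_Schwarz[OF Q, of x a] by (simp add: diag divide_le_eq)
    qed
  qed
qed

text \<open>Eliminating a dense sequence \<open>a\<^sub>0, a\<^sub>1, \<dots>\<close> one vector after the other leaves residual forms that
  decrease and vanish on the vectors already eliminated. A residual evaluated at \<open>x\<close> is therefore at
  most \<open>B \<parallel>x - a\<^sub>j\<parallel>\<^sup>2\<close> for every eliminated \<open>a\<^sub>j\<close>, so the residuals tend to 0. For the inner product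
  this is the Gram--Schmidt process; other forms are decomposed without completing the space in the
  new norm or taking the square root of an operator.\<close>

theorem pos_form_eq_suminf:
  fixes Q :: "'b::complex_inner \<Rightarrow> 'b \<Rightarrow> complex" and a :: "nat \<Rightarrow> 'b"
  assumes Q: "pos_form Q" and bdd: "\<And>x. Re (Q x x) \<le> B * (norm x)\<^sup>2"
    and dense: "closure (range a) = UNIV"
  shows "\<exists>\<phi>::nat \<Rightarrow> 'b \<Rightarrow> complex. (\<forall>m x y. \<phi> m (x + y) = \<phi> m x + \<phi> m y) \<and>
    (\<forall>m c x. \<phi> m (c *\<^sub>C x) = c * \<phi> m x) \<and> (\<forall>x y. (\<lambda>m. \<phi> m x * cnj (\<phi> m y)) sums Q x y)"
proof -
  define q where "q = rec_nat Q (\<lambda>m Q'. schur_complement Q' (a m))"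
  have q0: "q 0 = Q" and qSuc: "q (Suc m) = schur_complement (q m) (a m)" for m
    by (simp_all add: q_def)
  have pos: "pos_form (q m)" for m
    by (induction m) (simp_all add: q0 qSuc Q pos_form_schur_complement)
  have mono: "Re (q n x x) \<le> Re (q m x x)" if "m \<le> n" for m n x
    using that
    by (induction n rule: dec_induct)
      (auto simp: qSuc intro: order_trans[OF schur_complement_le[OF pos]])
  define \<phi> where "\<phi> m x = q m x (a m) / complex_of_real (sqrt (Re (q m (a m) (a m))))" for m x
  have \<phi>: "\<phi> m x * cnj (\<phi> m y) = q m x y - q (Suc m) x y" for m x y
  proof -
    define r where "r = sqrt (Re (q m (a m) (a m)))"
    have "r * r = Re (q m (a m) (a m))"
      using pos_form_nonneg[OF pos, of m "a m"] by (simp add: r_def)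
    then have r: "complex_of_real r * complex_of_real r = q m (a m) (a m)"
      using pos_form_self_real[OF pos, of m "a m"] by (metis of_real_mult)
    have "cnj (q m y (a m)) = q m (a m) y"
      using pos_form_commute[OF pos] by metis
    then have "\<phi> m x * cnj (\<phi> m y) =
        q m x (a m) * q m (a m) y / (complex_of_real r * complex_of_real r)"
      unfolding \<phi>_def r_def[symmetric] by simp
    also note r
    finally show ?thesis by (simp add: qSuc schur_complement_def)
  qed
  have sum: "(\<Sum>m<n. \<phi> m x * cnj (\<phi> m y)) = Q x y - q n x y" for n x y
    by (induction n) (simp_all add: q0 \<phi>)
  have residual: "Re (q n x x) \<le> B * (norm (x - a j))\<^sup>2" if "j < n" for n j x
  proof -
    have "Re (q n (a j) (a j)) \<le> Re (q (Suc j) (a j) (a j))"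
      using that by (intro mono) simp
    then have "Re (q n (a j) (a j)) = 0"
      using pos_form_nonneg[OF pos, of n "a j"] schur_complement_self[OF pos] by (simp add: qSuc)
    then have null: "q n y (a j) = 0" "q n (a j) y = 0" for y
      using pos_form_eq_0[OF pos] by blast+
    have "q n x x = q n ((x - a j) + a j) ((x - a j) + a j)" by simp
    also have "\<dots> = q n (x - a j) (x - a j)"
      by (simp only: pos_form_add_left[OF pos] pos_form_add_right[OF pos] null) simp
    finally have "Re (q n x x) \<le> Re (Q (x - a j) (x - a j))"
      using mono[of 0 n "x - a j"] by (simp add: q0)
    also have "\<dots> \<le> B * (norm (x - a j))\<^sup>2" by (rule bdd)
    finally show ?thesis .
  qed
  have lim0: "(\<lambda>n. Re (q n x x)) \<longlonglongrightarrow> 0" for x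
  proof (rule LIMSEQ_I)
    fix e :: real assume "e > 0"
    define r where "r = sqrt (e / (\<bar>B\<bar> + 1))"
    have "r > 0" using \<open>e > 0\<close> by (simp add: r_def)
    moreover have "x \<in> closure (range a)" by (simp add: dense)
    ultimately obtain j where "dist (a j) x < r"
      unfolding closure_approachable by blast
    then have "(norm (x - a j))\<^sup>2 < r\<^sup>2"
      by (intro power_strict_mono) (auto simp: dist_norm norm_minus_commute)
    then have "(norm (x - a j))\<^sup>2 < e / (\<bar>B\<bar> + 1)"
      using \<open>e > 0\<close> by (simp add: r_def)
    then have "(\<bar>B\<bar> + 1) * (norm (x - a j))\<^sup>2 < e" by (simp add: field_simps)
    moreover have "B * (norm (x - a j))\<^sup>2 \<le> (\<bar>B\<bar> + 1) * (norm (x - a j))\<^sup>2"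
      by (intro mult_right_mono) auto
    ultimately have "B * (norm (x - a j))\<^sup>2 < e" by linarith
    then have "norm (Re (q n x x) - 0) < e" if "n \<ge> Suc j" for n
      using residual[of j n x] pos_form_nonneg[OF pos, of n x] that by simp
    then show "\<exists>n0. \<forall>n\<ge>n0. norm (Re (q n x x) - 0) < e" by blast
  qed
  have "(\<lambda>n. q n x y) \<longlonglongrightarrow> 0" for x y
  proof (rule Lim_null_comparison)
    have "cmod (q n x y) \<le> sqrt (Re (q n x x) * Re (q n y y))" for n
      using pos_form_Cauchy_Schwarz[OF pos, of n x y] by (rule real_le_rsqrt)
    then show "\<forall>\<^sub>F n in sequentially. cmod (q n x y) \<le> sqrt (Re (q n x x) * Re (q n y y))"
      by simp
    show "(\<lambda>n. sqrt (Re (q n x x) * Re (q n y y))) \<longlonglongrightarrow> 0"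
      using tendsto_real_sqrt[OF tendsto_mult[OF lim0[of x] lim0[of y]]] by simp
  qed
  then have "(\<lambda>n. Q x y - q n x y) \<longlonglongrightarrow> Q x y - 0" for x y
    by (intro tendsto_diff tendsto_const)
  then have "(\<lambda>m. \<phi> m x * cnj (\<phi> m y)) sums Q x y" for x y
    unfolding sums_def sum by simp
  moreover have "\<phi> m (x + y) = \<phi> m x + \<phi> m y" "\<phi> m (c *\<^sub>C x) = c * \<phi> m x" for m x y c
    by (simp_all add: \<phi>_def pos_form_add_left[OF pos] pos_form_scaleC_left[OF pos] add_divide_distrib)
  ultimately show ?thesis by blast
qed

section \<open>Orthogonal projections and compressions\<close>

lemma closed_csubspace_diff:
  assumes "closed_csubspace L" "x \<in> L" "y \<in> L"
  shows "x - y \<in> L"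
proof -
  have "(- 1) *\<^sub>C y = - y"
    using scaleC.minus_left[of 1 y] by (simp add: scaleC_one)
  then show ?thesis
    using assms unfolding closed_csubspace_def by (metis diff_conv_add_uminus)
qed

text \<open>A minimizing sequence for the distance is Cauchy by the parallelogram law.\<close>

lemma orth_proj_exists:
  fixes L :: "'a::chilbert_space set"
  assumes L: "closed_csubspace L"
  shows "\<exists>y. y \<in> L \<and> (\<forall>z\<in>L. cinner (x - y) z = 0)"
proof -
  have add: "y + z \<in> L" if "y \<in> L" "z \<in> L" for y z
    using L that by (auto simp: closed_csubspace_def)
  have scale: "c *\<^sub>C y \<in> L" if "y \<in> L" for c y
    using L that by (auto simp: closed_csubspace_def)
  have "0 \<in> L" "closed L" using L by (auto simp: closed_csubspace_def)
  define d where "d = (INF y\<in>L. (norm (x - y))\<^sup>2)"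
  have bdd: "bdd_below ((\<lambda>y. (norm (x - y))\<^sup>2) ` L)" by (rule bdd_belowI[of _ 0]) auto
  have d: "d \<le> (norm (x - y))\<^sup>2" if "y \<in> L" for y
    unfolding d_def using bdd that by (rule cINF_lower)
  have "\<exists>y\<in>L. (norm (x - y))\<^sup>2 < d + e" if "e > 0" for e
    using cINF_less_iff[OF _ bdd, of "d + e"] \<open>0 \<in> L\<close> that unfolding d_def[symmetric] by auto
  then have "\<exists>y. y \<in> L \<and> (norm (x - y))\<^sup>2 < d + inverse (real (Suc k))" for k
    by (meson inverse_positive_iff_positive of_nat_0_less_iff zero_less_Suc)
  then obtain y where y: "\<And>k. y k \<in> L" "\<And>k. (norm (x - y k))\<^sup>2 < d + inverse (real (Suc k))"
    by metis
  have par: "(norm (y k - y l))\<^sup>2 \<le> 2 * inverse (real (Suc k)) + 2 * inverse (real (Suc l))" for k l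
  proof -
    define m where "m = (1 / 2) *\<^sub>R (y k + y l)"
    have "m \<in> L" unfolding m_def scaleR_scaleC by (intro scale add y)
    have m: "(x - y l) + (x - y k) = 2 *\<^sub>R (x - m)"
      by (simp add: m_def scaleR_diff_right scaleR_2)
    have "(norm (y k - y l))\<^sup>2 = (norm ((x - y l) - (x - y k)))\<^sup>2" by simp
    also have "\<dots> = 2 * (norm (x - y l))\<^sup>2 + 2 * (norm (x - y k))\<^sup>2 - (norm ((x - y l) + (x - y k)))\<^sup>2"
      unfolding norm_diff_sq norm_add_sq by simp
    also have "(norm ((x - y l) + (x - y k)))\<^sup>2 = 4 * (norm (x - m))\<^sup>2"
      unfolding m by (simp add: power_mult_distrib)
    finally show ?thesis using d[OF \<open>m \<in> L\<close>] y(2)[of k] y(2)[of l] by linarith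
  qed
  have "Cauchy y"
  proof (rule metric_CauchyI)
    fix e :: real assume "e > 0"
    then have "e\<^sup>2 / 4 > 0" by simp
    then obtain K where K: "inverse (real (Suc K)) < e\<^sup>2 / 4"
      using reals_Archimedean by blast
    have "dist (y k) (y l) < e" if "k \<ge> K" "l \<ge> K" for k l
    proof -
      have "inverse (real (Suc k)) \<le> inverse (real (Suc K))" "inverse (real (Suc l)) \<le> inverse (real (Suc K))"
        using that by (auto intro!: le_imp_inverse_le)
      then have "(norm (y k - y l))\<^sup>2 < e\<^sup>2" using par[of k l] K by linarith
      then show ?thesis
        using \<open>e > 0\<close> by (simp add: dist_norm power2_less_imp_less)
    qed
    then show "\<exists>K. \<forall>k\<ge>K. \<forall>l\<ge>K. dist (y k) (y l) < e" by blast
  qed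
  then obtain p where p: "y \<longlonglongrightarrow> p"
    using Cauchy_convergent convergent_def by blast
  have "p \<in> L" using \<open>closed L\<close> y(1) p by (rule closed_sequentially)
  have "(norm (x - p))\<^sup>2 \<le> d + 0"
  proof (rule LIMSEQ_le)
    show "(\<lambda>k. (norm (x - y k))\<^sup>2) \<longlonglongrightarrow> (norm (x - p))\<^sup>2" by (intro tendsto_intros p)
    show "(\<lambda>k. d + inverse (real (Suc k))) \<longlonglongrightarrow> d + 0"
      by (intro tendsto_intros LIMSEQ_inverse_real_of_nat)
    show "\<exists>K. \<forall>k\<ge>K. (norm (x - y k))\<^sup>2 \<le> d + inverse (real (Suc k))"
      using y(2) less_imp_le by blast
  qed
  then have min: "(norm (x - p))\<^sup>2 \<le> (norm (x - z))\<^sup>2" if "z \<in> L" for z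
    using d[OF that] by linarith
  have "cinner (x - p) z = 0" if "z \<in> L" for z
  proof (rule ccontr)
    assume nz: "cinner (x - p) z \<noteq> 0"
    define s where "s = cinner (x - p) z"
    define t where "t = 1 / (norm z)\<^sup>2"
    define c where "c = - (of_real t * s)"
    have "z \<noteq> 0" using nz by (auto simp: cinner.zero_right)
    then have t: "t > 0" "t * (norm z)\<^sup>2 = 1" by (simp_all add: t_def)
    have "(norm (x - p))\<^sup>2 \<le> (norm ((x - p) + c *\<^sub>C z))\<^sup>2"
      using min[OF closed_csubspace_diff[OF L \<open>p \<in> L\<close> scale[OF that, of c]]] by (simp add: algebra_simps)
    also have "\<dots> = (norm (x - p))\<^sup>2 + 2 * Re (cnj c * s) + (cmod c)\<^sup>2 * (norm z)\<^sup>2"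
      unfolding norm_add_sq by (simp add: cinner_scaleC_right s_def norm_scaleC power_mult_distrib)
    also have "Re (cnj c * s) = - (t * (cmod s)\<^sup>2)"
      unfolding c_def cmod_power2 by (simp add: power2_eq_square algebra_simps)
    also have "(cmod c)\<^sup>2 * (norm z)\<^sup>2 = t * (cmod s)\<^sup>2 * (t * (norm z)\<^sup>2)"
      by (simp add: c_def norm_mult power_mult_distrib power2_eq_square)
    finally have "t * (cmod s)\<^sup>2 \<le> 0" unfolding t(2) by simp
    then show False using t(1) nz by (simp add: s_def mult_le_0_iff)
  qed
  then show ?thesis using \<open>p \<in> L\<close> by blast
qed

lemma
  fixes L :: "'a::chilbert_space set"
  assumes L: "closed_csubspace L"
  shows orth_proj_in: "orth_proj L x \<in> L"
    and orth_proj_orthogonal: "z \<in> L \<Longrightarrow> cinner (x - orth_proj L x) z = 0"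
proof -
  have "\<exists>!y. y \<in> L \<and> (\<forall>z\<in>L. cinner (x - y) z = 0)"
  proof (rule ex_ex1I[OF orth_proj_exists[OF L]])
    fix y y' assume y: "y \<in> L \<and> (\<forall>z\<in>L. cinner (x - y) z = 0)" "y' \<in> L \<and> (\<forall>z\<in>L. cinner (x - y') z = 0)"
    then have "y - y' \<in> L" using closed_csubspace_diff[OF L] by blast
    then have "cinner (x - y') (y - y') - cinner (x - y) (y - y') = 0" using y by simp
    then have "cinner (y - y') (y - y') = 0"
      unfolding cinner.diff_left[symmetric] by simp
    then show "y = y'" by (simp add: cinner_self)
  qed
  then have *: "orth_proj L x \<in> L \<and> (\<forall>z\<in>L. cinner (x - orth_proj L x) z = 0)"
    unfolding orth_proj_def by (rule theI')
  then show "orth_proj L x \<in> L" "z \<in> L \<Longrightarrow> cinner (x - orth_proj L x) z = 0" by blast+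
qed

lemma
  fixes L :: "'a::complex_inner set"
  assumes L: "0 \<in> L" and bd: "\<And>x. x \<in> L \<Longrightarrow> norm (f x) \<le> K * norm x" and "K \<ge> 0"
  shows onorm_on_le: "onorm_on L f \<le> K" and onorm_on_nonneg: "0 \<le> onorm_on L f"
proof -
  have le: "norm (f x) / norm x \<le> K" if "x \<in> L" for x
    using bd[OF that] \<open>K \<ge> 0\<close> by (cases "norm x = 0") (auto simp: divide_le_eq)
  show "onorm_on L f \<le> K"
    unfolding onorm_on_def using L le by (intro cSUP_least) auto
  have "norm (f 0) / norm (0 :: 'a) \<le> onorm_on L f"
    unfolding onorm_on_def using le
    by (rule cSUP_upper[OF L, of "\<lambda>x. norm (f x) / norm x", OF bdd_aboveI2])
  then show "0 \<le> onorm_on L f" by simp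
qed

text \<open>The range of an isometry is complete.\<close>

lemma closed_csubspace_range:
  fixes V :: "'b::chilbert_space \<Rightarrow> 'a::chilbert_space"
  assumes V: "bounded_clinear V" and norm_V: "\<And>x. norm (V x) = norm x"
  shows "closed_csubspace (range V)"
proof -
  note lin = linear_simps[OF bounded_clinear_bounded_linear[OF V]]
  have "closed (range V)"
    unfolding closed_sequential_limits
  proof (intro allI impI, elim conjE)
    fix f l assume f: "\<forall>n. f n \<in> range V" and l: "f \<longlonglongrightarrow> l"
    then obtain x where x: "\<And>n. f n = V (x n)" by (meson imageE)
    have Vl: "(\<lambda>n. V (x n)) \<longlonglongrightarrow> l" using l unfolding x[abs_def] .
    have "convergent x"
    proof (rule convergent_if_bounded_below[where A = V, OF zero_less_one _ Vl])
      show "1 * norm (x k - x l) \<le> norm (V (x k) - V (x l))" for k l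
        unfolding lin(2)[symmetric] norm_V by simp
    qed
    then obtain x' where "x \<longlonglongrightarrow> x'" by (auto simp: convergent_def)
    then have "(\<lambda>n. V (x n)) \<longlonglongrightarrow> V x'"
      by (rule bounded_linear.tendsto[OF bounded_clinear_bounded_linear[OF V]])
    then show "l \<in> range V" using Vl LIMSEQ_unique by blast
  qed
  moreover have "0 \<in> range V" by (rule range_eqI[of _ _ 0]) (simp add: lin)
  moreover have "x + y \<in> range V" if "x \<in> range V" "y \<in> range V" for x y
    using that by (auto simp flip: lin(1))
  moreover have "c *\<^sub>C x \<in> range V" if "x \<in> range V" for c x
    using that by (auto simp flip: bounded_clinear_scaleC[OF V])
  ultimately show ?thesis unfolding closed_csubspace_def by blast
qed

section \<open>Power boundedness\<close>

text \<open>By Baire's theorem the maps have a common bound on some ball; moving its centre to the origin gives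
  the bound on the norms.\<close>

lemma uniform_boundedness:
  fixes f :: "'i \<Rightarrow> 'a::banach \<Rightarrow> 'c::real_normed_vector"
  assumes lin: "\<And>i. bounded_linear (f i)" and bdd: "\<And>x. \<exists>K. \<forall>i. norm (f i x) \<le> K"
  shows "\<exists>K. \<forall>i x. norm (f i x) \<le> K * norm x"
proof -
  define A where "A n = {x. \<forall>i. norm (f i x) \<le> real n}" for n
  have clo: "closed (A n)" for n
  proof -
    have "A n = (\<Inter>i. {x. norm (f i x) \<le> real n})" by (auto simp: A_def)
    moreover have "closed {x. norm (f i x) \<le> real n}" for i
      using lin[of i] by (intro closed_Collect_le continuous_intros linear_continuous_on) 
    ultimately show ?thesis by auto
  qed
  have "(\<Union>n. A n) = UNIV"
  proof -
    have "\<exists>n. x \<in> A n" for x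
    proof -
      obtain K where "\<forall>i. norm (f i x) \<le> K" using bdd by blast
      then have "x \<in> A (nat \<lceil>K\<rceil>)"
        unfolding A_def using order_trans[OF _ real_nat_ceiling_ge] by blast
      then show ?thesis ..
    qed
    then show ?thesis by auto
  qed
  moreover have "interior (\<Union>n. A n) = {}" if "\<And>n. interior (A n) = {}"
    using Met_TC.metric_Baire_category_alt[of "range A"] that clo
    by (auto simp: interior_of_def interior_def complete_UNIV mcomplete_iff_complete)
  ultimately obtain n where "interior (A n) \<noteq> {}"
    by auto
  then obtain x0 r where r: "r > 0" "cball x0 r \<subseteq> A n"
    by (metis all_not_in_conv mem_interior_cball)
  have "norm (f i x) \<le> (2 * real n / r) * norm x" for i x
  proof (cases "x = 0")
    case True
    then show ?thesis using lin[of i] by (simp add: linear_simps)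
  next
    case False
    define y where "y = (r / norm x) *\<^sub>R x"
    have "x0 + y \<in> A n" "x0 \<in> A n"
      using r False by (auto intro!: subsetD[OF r(2)] simp: y_def dist_norm)
    then have "norm (f i (x0 + y)) \<le> n" "norm (f i x0) \<le> n"
      by (auto simp: A_def)
    then have "norm (f i y) \<le> 2 * real n"
      using norm_triangle_ineq4[of "f i (x0 + y)" "f i x0"] lin[of i] by (simp add: linear_simps)
    moreover have "norm (f i y) = (r / norm x) * norm (f i x)"
      using lin[of i] r by (simp add: y_def linear_simps)
    ultimately show ?thesis using r False by (simp add: field_simps)
  qed
  then show ?thesis by blast
qed

locale circle_operator =
  fixes T :: "'a::chilbert_space \<Rightarrow> 'a"
  assumes clinear: "bounded_clinear T"
    and wot: "wot_tendsto (\<lambda>n. T ^^ n) (\<lambda>x. 0) sequentially"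
    and circle: "{z. cmod z = 1} \<subseteq> op_spectrum T"
begin

lemma weakly_null: "(\<lambda>n. cinner ((T ^^ n) x) y) \<longlonglongrightarrow> 0"
  using wot by (simp add: wot_tendsto_def cinner.zero_left)

lemma pow_linear: "bounded_linear (T ^^ n)"
  by (intro bounded_clinear_bounded_linear bounded_clinear_pow clinear)

lemmas T_linear = bounded_clinear_bounded_linear[OF clinear]

lemma pow_scaleC: "(T ^^ n) (c *\<^sub>C x) = c *\<^sub>C (T ^^ n) x"
  by (intro bounded_clinear_scaleC bounded_clinear_pow clinear)

lemmas pow_simps = linear_add[OF bounded_linear.linear[OF pow_linear]]
  linear_diff[OF bounded_linear.linear[OF pow_linear]]
  linear_sum[OF bounded_linear.linear[OF pow_linear]] pow_scaleC

text \<open>Uniform boundedness is applied twice, first to the functionals \<open>\<langle>T\<^sup>n x, \<cdot>\<rangle>\<close> for a fixed \<open>x\<close> and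
  then to the operators \<open>T\<^sup>n\<close>.\<close>

lemma power_bounded_ex: "\<exists>M. 1 \<le> M \<and> (\<forall>n x. norm ((T ^^ n) x) \<le> M * norm x)"
proof -
  have "\<exists>K. \<forall>n. norm ((T ^^ n) x) \<le> K" for x
  proof -
    have "\<exists>K. \<forall>n y. norm (cinner ((T ^^ n) x) y) \<le> K * norm y"
    proof (rule uniform_boundedness)
      fix y
      have "Bseq (\<lambda>n. cinner ((T ^^ n) x) y)"
        using weakly_null convergentI by (intro convergent_imp_Bseq) blast
      then show "\<exists>K. \<forall>n. norm (cinner ((T ^^ n) x) y) \<le> K"
        unfolding Bseq_def by blast
    qed (rule cinner.bounded_linear_right)
    then obtain K where K: "\<And>n y. norm (cinner ((T ^^ n) x) y) \<le> K * norm y" by blast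
    have "norm ((T ^^ n) x) \<le> \<bar>K\<bar>" for n
    proof -
      have "norm ((T ^^ n) x) * norm ((T ^^ n) x) \<le> K * norm ((T ^^ n) x)"
        using K[of n "(T ^^ n) x"] by (simp add: cinner_self norm_power power2_eq_square norm_mult)
      then show ?thesis
        by (cases "norm ((T ^^ n) x) = 0") (auto simp: mult_le_cancel_right)
    qed
    then show ?thesis by blast
  qed
  then obtain K where K: "\<And>n x. norm ((T ^^ n) x) \<le> K * norm x"
    using uniform_boundedness[of "\<lambda>n. T ^^ n", OF pow_linear] by blast
  have "norm ((T ^^ n) x) \<le> max 1 K * norm x" for n x
    using K[of n x] mult_right_mono[of K "max 1 K" "norm x"] by simp
  then show ?thesis by (intro exI[of _ "max 1 K"]) simp
qed

definition M :: real
  where "M = (SOME M. 1 \<le> M \<and> (\<forall>n x. norm ((T ^^ n) x) \<le> M * norm x))"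

lemma M_ge_1: "1 \<le> M" and power_bounded: "norm ((T ^^ n) x) \<le> M * norm x"
  using someI_ex[OF power_bounded_ex] unfolding M_def by blast+

section \<open>Approximate eigenvectors\<close>

text \<open>For an eigenvector, \<open>\<bar>\<langle>T\<^sup>n x, x\<rangle>\<bar>\<close> would not depend on \<open>n\<close>.\<close>

lemma no_eigenvector:
  assumes "cmod z = 1" "T x = z *\<^sub>C x"
  shows "x = 0"
proof -
  have "(T ^^ n) x = (z ^ n) *\<^sub>C x" for n
  proof (induction n)
    case (Suc n)
    then show ?case
      using assms(2) bounded_clinear_scaleC[OF clinear] by (simp add: scaleC_scaleC mult.commute)
  qed (simp add: scaleC_one)
  then have "cmod (cinner ((T ^^ n) x) x) = (norm x)\<^sup>2" for n
    using assms(1) by (simp add: cinner_scaleC_left cinner_self norm_mult norm_power)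
  then have "(\<lambda>n. (norm x)\<^sup>2) \<longlonglongrightarrow> 0"
    using tendsto_norm[OF weakly_null, of x x] by simp
  then show ?thesis by (simp add: LIMSEQ_const_iff)
qed

text \<open>The Neumann series of the resolvent converges outside the disc by power boundedness.\<close>

lemma resolvent_surj:
  assumes "cmod z > 1"
  shows "\<exists>x. z *\<^sub>C x - T x = y"
proof -
  define a where "a n = (1 / z) ^ Suc n *\<^sub>C (T ^^ n) y" for n
  have z: "z \<noteq> 0" using assms by auto
  have "summable a"
  proof (rule summable_comparison_test')
    have "summable (\<lambda>n. (1 / cmod z) ^ n)"
      using assms by (intro summable_geometric) (simp add: divide_simps)
    then show "summable (\<lambda>n. (1 / cmod z) ^ n * (M * norm y))"
      by (rule summable_mult2)
    fix n
    have "norm (a n) = (1 / cmod z) ^ Suc n * norm ((T ^^ n) y)"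
      by (simp only: a_def norm_scaleC norm_power norm_divide norm_one)
    also have "\<dots> \<le> (1 / cmod z) ^ n * (M * norm y)"
      using assms by (intro mult_mono power_bounded power_decreasing) (auto simp: divide_simps)
    finally show "norm (a n) \<le> (1 / cmod z) ^ n * (M * norm y)" .
  qed
  then have s: "a sums suminf a" by (rule summable_sums)
  have "(\<lambda>n. z *\<^sub>C a n) sums (z *\<^sub>C suminf a)"
    using bounded_linear.sums[OF scaleC.bounded_linear_right s] .
  then have 1: "(\<lambda>n. z *\<^sub>C a (Suc n)) sums (z *\<^sub>C suminf a - y)"
    using z sums_Suc_iff[of "\<lambda>n. z *\<^sub>C a n"] by (simp add: a_def scaleC_scaleC scaleC_one)
  have 2: "(\<lambda>n. T (a n)) sums T (suminf a)"
    using bounded_linear.sums[OF T_linear s] .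
  have "z *\<^sub>C a (Suc n) = T (a n)" for n
    using z bounded_clinear_scaleC[OF clinear] by (simp add: a_def scaleC_scaleC)
  then have "z *\<^sub>C suminf a - y = T (suminf a)"
    using 1 2 sums_unique2 by (metis (no_types, lifting) sums_cong)
  then have "z *\<^sub>C suminf a - T (suminf a) = y"
    by (simp add: algebra_simps)
  then show ?thesis ..
qed

text \<open>Powers of \<^term>\<open>T\<close> being bounded, the circle lies on the boundary of the spectrum, and
  boundary points are approximate eigenvalues: if \<open>z - T\<close> were bounded below, the solutions of
  \<open>(t z - T) x = y\<close> for \<open>t > 1\<close> would converge as \<open>t\<close> tends to 1 to a solution of
  \<open>(z - T) x = y\<close>, so that \<open>z - T\<close> would be invertible.\<close>

lemma approximate_eigenvector:
  assumes z: "cmod z = 1" and "\<delta> > 0"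
  shows "\<exists>x. norm x = 1 \<and> norm (z *\<^sub>C x - T x) < \<delta>"
proof (rule ccontr)
  assume contra: "\<not> ?thesis"
  define A where "A x = z *\<^sub>C x - T x" for x
  have lin: "bounded_linear A"
    unfolding A_def by (intro bounded_linear_sub T_linear scaleC.bounded_linear_right)
  have A_scaleC: "A (c *\<^sub>C x) = c *\<^sub>C A x" for c x
    by (simp add: A_def bounded_clinear_scaleC[OF clinear] scaleC.diff_right scaleC_scaleC mult.commute)
  have below: "\<delta> * norm x \<le> norm (A x)" for x
  proof (cases "x = 0")
    case False
    have "norm ((1 / norm x) *\<^sub>R x) = 1" using False by simp
    then have "\<delta> \<le> norm (A ((1 / norm x) *\<^sub>R x))"
      using contra unfolding A_def by (meson not_less)
    also have "\<dots> = norm (A x) / norm x"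
      using lin by (simp add: linear_simps)
    finally show ?thesis using False by (simp add: field_simps)
  qed simp
  have surj: "\<exists>x. A x = y" for y
  proof -
    \<comment> \<open>up to distance \<open>\<delta> / 2\<close> from \<open>z\<close>, half of the lower bound survives\<close>
    define t where "t k = 1 + \<delta> / 2 / real (Suc k)" for k
    have t: "t k > 1" "t k - 1 \<le> \<delta> / 2" for k
    proof -
      show "t k > 1" using \<open>\<delta> > 0\<close> by (simp add: t_def)
      have "\<delta> / 2 / real (Suc k) \<le> \<delta> / 2 / 1"
        using \<open>\<delta> > 0\<close> by (intro divide_left_mono) auto
      then show "t k - 1 \<le> \<delta> / 2" by (simp add: t_def)
    qed
    have "\<exists>x. (of_real (t k) * z) *\<^sub>C x - T x = y" for k
      using resolvent_surj[of "of_real (t k) * z" y] t(1)[of k] z by (simp add: norm_mult)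
    then obtain x where x: "\<And>k. (of_real (t k) * z) *\<^sub>C x k - T (x k) = y" by metis
    have Ax: "y - A (x k) = of_real (t k - 1) *\<^sub>C z *\<^sub>C x k" for k
      unfolding x[of k, symmetric] A_def
      by (simp add: scaleC_scaleC algebra_simps flip: scaleC.diff_left)
    have nAx: "norm (y - A (x k)) = (t k - 1) * norm (x k)" for k
      unfolding Ax norm_scaleC norm_of_real z using t(1)[of k] by simp
    have bound: "norm (x k) \<le> 2 * norm y / \<delta>" for k
    proof -
      have "\<delta> * norm (x k) \<le> norm y + norm (y - A (x k))"
        using below[of "x k"] norm_triangle_ineq4[of y "y - A (x k)"] by simp
      also have "\<dots> \<le> norm y + \<delta> / 2 * norm (x k)"
        unfolding nAx using t(2)[of k] by (intro add_left_mono mult_right_mono) auto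
      finally show ?thesis using \<open>\<delta> > 0\<close> by (simp add: field_simps)
    qed
    have "(\<lambda>k. y - A (x k)) \<longlonglongrightarrow> 0"
    proof (rule Lim_null_comparison)
      show "\<forall>\<^sub>F k in sequentially. norm (y - A (x k)) \<le> (t k - 1) * (2 * norm y / \<delta>)"
        unfolding nAx using t(1) bound
        by (intro always_eventually allI mult_left_mono) (auto intro: less_imp_le)
      have "(\<lambda>k. (\<delta> / 2) * inverse (real (Suc k))) \<longlonglongrightarrow> (\<delta> / 2) * 0"
        by (intro tendsto_mult tendsto_const LIMSEQ_inverse_real_of_nat)
      then have "(\<lambda>k. t k - 1) \<longlonglongrightarrow> 0"
        by (simp add: t_def field_simps)
      then show "(\<lambda>k. (t k - 1) * (2 * norm y / \<delta>)) \<longlonglongrightarrow> 0"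
        by (rule tendsto_mult_left_zero)
    qed
    then have lim: "(\<lambda>k. A (x k)) \<longlonglongrightarrow> y"
      using tendsto_diff[OF tendsto_const[of y]] by fastforce
    have "convergent x"
    proof (rule convergent_if_bounded_below[where A = A, OF \<open>\<delta> > 0\<close> _ lim])
      show "\<delta> * norm (x k - x l) \<le> norm (A (x k) - A (x l))" for k l
        using below[of "x k - x l"] by (simp add: linear_simps[OF lin])
    qed
    then obtain x' where "x \<longlonglongrightarrow> x'" by (auto simp: convergent_def)
    then have "(\<lambda>k. A (x k)) \<longlonglongrightarrow> A x'" by (rule bounded_linear.tendsto[OF lin])
    then show ?thesis using lim LIMSEQ_unique by blast
  qed
  have inj: "x = x'" if "A x = A x'" for x x'
    using below[of "x - x'"] that \<open>\<delta> > 0\<close> lin by (simp add: linear_simps mult_le_0_iff)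
  obtain S where S: "\<And>y. A (S y) = y" using surj by metis
  have SA: "S (A x) = x" for x by (rule inj) (simp add: S)
  have "bounded_clinear S"
    unfolding bounded_clinear_def
  proof (intro conjI allI)
    show "S (c *\<^sub>C x) = c *\<^sub>C S x" for c x
      by (rule inj) (simp add: S A_scaleC)
    show "bounded_linear S"
    proof (rule bounded_linear_intro)
      show "S (x + y) = S x + S y" for x y
        by (rule inj) (simp add: S linear_simps[OF lin])
      show "S (r *\<^sub>R x) = r *\<^sub>R S x" for r x
        by (rule inj) (simp add: S linear_simps[OF lin])
      show "norm (S x) \<le> norm x * (1 / \<delta>)" for x
        using below[of "S x"] \<open>\<delta> > 0\<close> by (simp add: S field_simps)
    qed
  qed
  then have "z \<notin> op_spectrum T"
    unfolding op_spectrum_def using S SA unfolding A_def by blast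
  then show False using circle z by blast
qed

text \<open>As \<open>z\<close> is not an eigenvalue, \<open>z - T\<close> cannot become bounded below on a subspace of finite
  codimension: approximate eigenvectors modulo one direction accumulate at an eigenvector.\<close>

lemma approximate_eigenvector_orthogonal:
  assumes z: "cmod z = 1" and "finite G" and "\<delta> > 0"
  shows "\<exists>x. norm x = 1 \<and> (\<forall>g\<in>G. cinner x g = 0) \<and> norm (z *\<^sub>C x - T x) < \<delta>"
  using \<open>finite G\<close> \<open>\<delta> > 0\<close>
proof (induction G arbitrary: \<delta>)
  case empty
  then show ?case using approximate_eigenvector[OF z] by auto
next
  case (insert g G)
  define A where "A x = z *\<^sub>C x - T x" for x
  have lin: "bounded_linear A"
    unfolding A_def by (intro bounded_linear_sub T_linear scaleC.bounded_linear_right)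
  note lin' = linear_simps[OF lin]
  show ?case
  proof (cases "\<exists>h. (\<forall>g\<in>G. cinner h g = 0) \<and> cinner h g \<noteq> 0")
    case False
    then show ?thesis using insert.IH[OF insert.prems] by blast
  next
    case True
    then obtain h0 where h0: "\<And>g. g \<in> G \<Longrightarrow> cinner h0 g = 0" "cinner h0 g \<noteq> 0" by blast
    define h where "h = (1 / cinner h0 g) *\<^sub>C h0"
    have h: "cinner h g' = 0" if "g' \<in> G" for g'
      using h0 that by (simp add: h_def cinner_scaleC_left)
    have hg: "cinner h g = 1" using h0 by (simp add: h_def cinner_scaleC_left)
    show ?thesis
    proof (rule ccontr)
      assume contra: "\<not> ?thesis"
      have below: "\<delta> * norm x \<le> norm (A x)" if "\<And>g'. g' \<in> insert g G \<Longrightarrow> cinner x g' = 0" for x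
      proof (cases "x = 0")
        case False
        have "norm ((1 / norm x) *\<^sub>R x) = 1" using False by simp
        moreover have "\<forall>g'\<in>insert g G. cinner ((1 / norm x) *\<^sub>R x) g' = 0"
          using that by (simp add: cinner_scaleR_left)
        ultimately have "\<delta> \<le> norm (A ((1 / norm x) *\<^sub>R x))"
          using contra unfolding A_def by (meson not_less)
        also have "\<dots> = norm (A x) / norm x"
          by (simp add: lin')
        finally show ?thesis using False by (simp add: field_simps)
      qed simp
      have "\<exists>x. norm x = 1 \<and> (\<forall>g\<in>G. cinner x g = 0) \<and> norm (A x) < inverse (real (Suc k))" for k
        using insert.IH[of "inverse (real (Suc k))"] by (simp add: A_def)
      then obtain x where x: "\<And>k. norm (x k) = 1" "\<And>k g. g \<in> G \<Longrightarrow> cinner (x k) g = 0"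
        and Ax: "\<And>k. norm (A (x k)) < inverse (real (Suc k))" by metis
      define \<alpha> where "\<alpha> k = cinner (x k) g" for k
      have "bounded (range \<alpha>)"
        unfolding bounded_iff \<alpha>_def using norm_cinner_le[of "x _" g] x(1) by auto
      then obtain a r where r: "strict_mono r" and a: "(\<alpha> \<circ> r) \<longlonglongrightarrow> a"
        using bounded_imp_convergent_subsequence by blast
      have "(\<lambda>k. A (x k)) \<longlonglongrightarrow> 0"
        using less_imp_le[OF Ax]
        by (intro Lim_null_comparison[OF always_eventually LIMSEQ_inverse_real_of_nat]) blast
      then have Axr: "(\<lambda>k. A (x (r k))) \<longlonglongrightarrow> 0"
        using LIMSEQ_subseq_LIMSEQ[OF _ r] by (auto simp: o_def)
      \<comment> \<open>the correction along \<open>h\<close> makes \<open>y k\<close> orthogonal to \<open>g\<close>, so that the lower bound applies to it\<close>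
      define y where "y k = x (r k) - \<alpha> (r k) *\<^sub>C h" for k
      have y: "cinner (y k) g' = 0" if "g' \<in> insert g G" for k g'
        using that x h hg by (auto simp: y_def cinner.diff_left cinner_scaleC_left \<alpha>_def)
      have ah: "(\<lambda>k. \<alpha> (r k) *\<^sub>C h) \<longlonglongrightarrow> a *\<^sub>C h"
        using bounded_linear.tendsto[OF scaleC.bounded_linear_left a] by (simp add: o_def)
      have Ay: "(\<lambda>k. A (y k)) \<longlonglongrightarrow> 0 - A (a *\<^sub>C h)"
        unfolding y_def lin' by (intro tendsto_diff Axr bounded_linear.tendsto[OF lin] ah)
      have "convergent y"
      proof (rule convergent_if_bounded_below[where A = A, OF \<open>\<delta> > 0\<close> _ Ay])
        show "\<delta> * norm (y k - y l) \<le> norm (A (y k) - A (y l))" for k l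
          using below[of "y k - y l"] y by (simp add: lin' cinner.diff_left)
      qed
      then obtain y' where "y \<longlonglongrightarrow> y'" by (auto simp: convergent_def)
      then have lim: "(\<lambda>k. x (r k)) \<longlonglongrightarrow> y' + a *\<^sub>C h"
        using tendsto_add[OF _ ah] by (fastforce simp: y_def)
      have "norm (y' + a *\<^sub>C h) = 1"
        using tendsto_norm[OF lim] x(1) by (simp add: LIMSEQ_const_iff)
      moreover have "A (y' + a *\<^sub>C h) = 0"
        using bounded_linear.tendsto[OF lin lim] Axr LIMSEQ_unique by blast
      then have "y' + a *\<^sub>C h = 0"
        using no_eigenvector[OF z] by (simp add: A_def)
      ultimately show False by simp
    qed
  qed
qed

lemma approximate_eigenvector_powers:
  assumes z: "cmod z = 1" and "finite G" and "\<delta> > 0"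
  shows "\<exists>x. norm x = 1 \<and> (\<forall>g\<in>G. cinner x g = 0) \<and>
    (\<forall>n\<le>R. norm ((T ^^ n) x - (z ^ n) *\<^sub>C x) \<le> \<delta>)"
proof -
  define d where "d = \<delta> / (real (Suc R) * M)"
  have M: "M > 0" using M_ge_1 by simp
  have "d > 0" using \<open>\<delta> > 0\<close> M by (simp add: d_def)
  then obtain x where x: "norm x = 1" "\<forall>g\<in>G. cinner x g = 0" "norm (z *\<^sub>C x - T x) < d"
    using approximate_eigenvector_orthogonal[OF z \<open>finite G\<close>] by blast
  have "norm ((T ^^ n) x - (z ^ n) *\<^sub>C x) \<le> real n * (M * d)" for n
  proof (induction n)
    case 0
    then show ?case by (simp add: scaleC_one)
  next
    case (Suc n)
    have "(T ^^ Suc n) x - (z ^ Suc n) *\<^sub>C x =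
        (T ^^ n) (T x - z *\<^sub>C x) + z *\<^sub>C ((T ^^ n) x - (z ^ n) *\<^sub>C x)"
      by (simp add: pow_simps funpow_swap1 scaleC.diff_right scaleC_scaleC)
    also have "norm \<dots> \<le> M * norm (T x - z *\<^sub>C x) + norm ((T ^^ n) x - (z ^ n) *\<^sub>C x)"
      using z by (intro norm_triangle_le add_mono power_bounded) (simp add: norm_scaleC)
    also have "\<dots> \<le> M * d + real n * (M * d)"
      using x(3) M Suc by (intro add_mono mult_left_mono) (auto simp: norm_minus_commute)
    finally show ?case by (simp add: algebra_simps)
  qed
  moreover have "real n * (M * d) \<le> \<delta>" if "n \<le> R" for n
  proof -
    have "real n * (M * d) = \<delta> * (real n / real (Suc R))"
      using M by (simp add: d_def)
    also have "\<dots> \<le> \<delta>" using \<open>\<delta> > 0\<close> that by (simp add: mult_le_cancel_left1 divide_le_eq)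
    finally show ?thesis .
  qed
  ultimately show ?thesis using x by (meson order_trans)
qed

lemma approximate_eigenvector_system:
  fixes z :: "nat \<Rightarrow> complex"
  assumes unit: "\<And>j. cmod (z j) = 1" and "finite G" and "\<delta> > 0"
  shows "\<exists>u. (\<forall>i<P. \<forall>j<P. cinner (u i) (u j) = (if i = j then 1 else 0)) \<and>
    (\<forall>j<P. (\<forall>g\<in>G. cinner (u j) g = 0) \<and>
      (\<forall>n\<le>R. norm ((T ^^ n) (u j) - (z j ^ n) *\<^sub>C u j) \<le> \<delta>))"
proof (induction P)
  case 0
  then show ?case by simp
next
  case (Suc P)
  then obtain u where u: "\<And>i j. i < P \<Longrightarrow> j < P \<Longrightarrow> cinner (u i) (u j) = (if i = j then 1 else 0)"
    "\<And>j g. j < P \<Longrightarrow> g \<in> G \<Longrightarrow> cinner (u j) g = 0"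
    "\<And>j n. j < P \<Longrightarrow> n \<le> R \<Longrightarrow> norm ((T ^^ n) (u j) - (z j ^ n) *\<^sub>C u j) \<le> \<delta>"
    by blast
  obtain x where x: "norm x = 1" "\<And>g. g \<in> G \<union> u ` {..<P} \<Longrightarrow> cinner x g = 0"
    "\<And>n. n \<le> R \<Longrightarrow> norm ((T ^^ n) x - (z P ^ n) *\<^sub>C x) \<le> \<delta>"
    using approximate_eigenvector_powers[OF unit[of P], of "G \<union> u ` {..<P}" \<delta> R] assms by auto
  have x': "cinner (u j) x = 0" if "j < P" for j
    using x(2)[of "u j"] that by (subst cinner_commute) simp
  show ?case
    by (rule exI[of _ "u(P := x)"])
      (use u x x' in \<open>auto simp: less_Suc_eq cinner_self\<close>)
qed

end

section \<open>Finite shift blocks\<close>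

lemma sum_powers_root_of_unity:
  fixes P a b :: nat
  assumes "a < P" "b < P" and w: "w = cis (2 * pi / real P)"
  shows "(\<Sum>j<P. (w ^ j) ^ a * cnj ((w ^ j) ^ b)) = (if a = b then of_nat P else 0)"
proof -
  have P: "P > 0" using assms by simp
  define \<zeta> where "\<zeta> = w ^ a * cnj (w ^ b)"
  have w1: "w * cnj w = 1" by (simp add: w cis_cnj cis_mult)
  have *: "(\<Sum>j<P. (w ^ j) ^ a * cnj ((w ^ j) ^ b)) = (\<Sum>j<P. \<zeta> ^ j)"
    by (intro sum.cong refl) (simp add: \<zeta>_def power_mult_distrib power_mult[symmetric] mult.commute)
  show ?thesis
  proof (cases "a = b")
    case True
    then have "\<zeta> = 1"
      using w1 by (simp add: \<zeta>_def power_mult_distrib[symmetric])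
    then show ?thesis using * True by simp
  next
    case False
    have wk: "w ^ k = cis (2 * pi * real k / real P)" for k
      by (simp add: w Complex.DeMoivre mult.commute)
    have "w ^ a \<noteq> w ^ b"
      using Complex.bij_betw_roots_unity[OF P] assms False unfolding wk bij_betw_def inj_on_def by auto
    moreover have "\<zeta> * w ^ b = w ^ a"
      using w1 by (simp add: \<zeta>_def power_mult_distrib[symmetric] mult.assoc mult.commute[of "cnj w"])
    ultimately have "\<zeta> \<noteq> 1" by auto
    have "w ^ P = 1" using P by (simp add: wk)
    then have "(w ^ k) ^ P = 1" for k by (metis power_mult mult.commute power_one)
    then have "\<zeta> ^ P = 1"
      by (simp only: \<zeta>_def power_mult_distrib complex_cnj_power[symmetric]) simp
    then have "(\<Sum>j<P. \<zeta> ^ j) = 0"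
      using \<open>\<zeta> \<noteq> 1\<close> by (simp add: geometric_sum)
    then show ?thesis using * False by simp
  qed
qed

context circle_operator
begin

text \<open>For \<open>P\<close> large, let \<open>u\<^sub>0, \<dots>, u\<^bsub>P-1\<^esub>\<close> be orthonormal approximate eigenvectors for the powers
  \<open>w\<^sup>j\<close> of a primitive \<open>P\<close>-th root of unity. On their span \<^term>\<open>T\<close> nearly is a cyclic shift, which
  the discrete Fourier transform brings to the form \<open>v\<^sub>k \<mapsto> v\<^bsub>k-1\<^esub>\<close>. A stretch of length \<open>N\<close> of the
  cycle does not notice the periodicity up to time \<open>P - N\<close>.\<close>

lemma shift_block_finite_time:
  assumes "finite G" and "\<delta> > 0"
  shows "\<exists>v. (\<forall>k<N. \<forall>l<N. cinner (v k) (v l) = (if k = l then 1 else 0)) \<and>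
    (\<forall>k<N. \<forall>g\<in>G. cinner (v k) g = 0) \<and>
    (\<forall>n\<le>R. \<forall>k<N. \<forall>l<N. cmod (cinner ((T ^^ n) (v k)) (v l) - (if k = l + n then 1 else 0)) \<le> \<delta>) \<and>
    (\<forall>n\<le>R. \<forall>k<N. \<forall>g\<in>G. cmod (cinner ((T ^^ n) (v k)) g) \<le> \<delta>)"
proof -
  \<comment> \<open>for \<open>n \<le> R\<close> and \<open>k, l < N\<close>, the residues of \<open>l + n\<close> and \<open>k\<close> modulo \<open>P\<close> agree only if \<open>k = l + n\<close>\<close>
  define P where "P = R + N + 1"
  have P: "P > 0" by (simp add: P_def)
  define w where "w = cis (2 * pi / real P)"
  have w: "cmod (w ^ j) = 1" for j by (simp add: w_def norm_power)
  obtain B where B: "B \<ge> 1" "\<And>g. g \<in> G \<Longrightarrow> norm g \<le> B"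
  proof
    show "1 + (\<Sum>g\<in>G. norm g) \<ge> 1" by (simp add: sum_nonneg)
    show "norm g \<le> 1 + (\<Sum>g\<in>G. norm g)" if "g \<in> G" for g
      using member_le_sum[of g G norm] that \<open>finite G\<close> by simp
  qed
  define d where "d = \<delta> / (real P * B)"
  have "d > 0" using assms B P by (simp add: d_def)
  then obtain u where u: "\<And>i j. i < P \<Longrightarrow> j < P \<Longrightarrow> cinner (u i) (u j) = (if i = j then 1 else 0)"
    and uG: "\<And>j g. j < P \<Longrightarrow> g \<in> G \<Longrightarrow> cinner (u j) g = 0"
    and uT: "\<And>j n. j < P \<Longrightarrow> n \<le> R \<Longrightarrow> norm ((T ^^ n) (u j) - ((w ^ j) ^ n) *\<^sub>C u j) \<le> d"
    using approximate_eigenvector_system[of "\<lambda>j. w ^ j" G d P R] w \<open>finite G\<close> by blast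
  define s where "s = complex_of_real (1 / sqrt (real P))"
  have ss: "s * cnj s * of_nat P = 1"
  proof -
    have "s * cnj s * of_nat P = complex_of_real (1 / sqrt (real P) * (1 / sqrt (real P)) * real P)"
      by (simp only: s_def complex_cnj_complex_of_real of_real_mult of_real_of_nat_eq)
    also have "\<dots> = 1" using P by simp
    finally show ?thesis .
  qed
  have "1 / sqrt (real P) \<le> 1" using P by simp
  then have s: "cmod s \<le> 1" unfolding s_def norm_of_real by simp
  \<comment> \<open>\<open>f n k\<close> stands for \<open>v\<^bsub>k-n\<^esub>\<close> in the cycle, to which \<open>T\<^sup>n v\<^sub>k\<close> is close; the block is \<open>f 0\<close>\<close>
  define f where "f n k = (\<Sum>j<P. (s * (w ^ j) ^ n * cnj ((w ^ j) ^ k)) *\<^sub>C u j)" for n k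
  have ff: "cinner (f n k) (f 0 l) = (if k = l + n then 1 else 0)" if "n \<le> R" "k < N" "l < N" for n k l
  proof -
    have "cinner (f n k) (f 0 l) = (\<Sum>j<P. s * cnj s * ((w ^ j) ^ (l + n) * cnj ((w ^ j) ^ k)))"
    proof -
      have "cinner (f n k) (f 0 l) =
          (\<Sum>j<P. (s * (w ^ j) ^ n * cnj ((w ^ j) ^ k)) * cnj (s * (w ^ j) ^ 0 * cnj ((w ^ j) ^ l)))"
        unfolding f_def by (rule cinner_orthonormal_sums) (auto simp: u)
      also have "\<dots> = (\<Sum>j<P. s * cnj s * ((w ^ j) ^ (l + n) * cnj ((w ^ j) ^ k)))"
      proof (rule sum.cong[OF refl])
        fix j
        show "(s * (w ^ j) ^ n * cnj ((w ^ j) ^ k)) * cnj (s * (w ^ j) ^ 0 * cnj ((w ^ j) ^ l)) =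
            s * cnj s * ((w ^ j) ^ (l + n) * cnj ((w ^ j) ^ k))"
          unfolding power_add complex_cnj_mult complex_cnj_cnj by simp
      qed
      finally show ?thesis .
    qed
    also have "\<dots> = s * cnj s * (if l + n = k then of_nat P else 0)"
      unfolding sum_distrib_left[symmetric]
      using that by (subst sum_powers_root_of_unity[OF _ _ w_def]) (auto simp: P_def)
    finally show ?thesis using ss by auto
  qed
  have fG: "cinner (f n k) g = 0" if "g \<in> G" for n k g
    using uG[OF _ that] by (simp add: f_def cinner.sum_left cinner_scaleC_left)
  have fT: "norm ((T ^^ n) (f 0 k) - f n k) \<le> real P * d" if "n \<le> R" for n k
  proof -
    have "(T ^^ n) (f 0 k) - f n k =
        (\<Sum>j<P. (s * cnj ((w ^ j) ^ k)) *\<^sub>C ((T ^^ n) (u j) - ((w ^ j) ^ n) *\<^sub>C u j))"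
      unfolding f_def pow_simps sum_subtractf[symmetric]
      by (intro sum.cong refl) (simp add: scaleC.diff_right scaleC_scaleC mult_ac)
    also have "norm \<dots> \<le> (\<Sum>j<P. d)"
    proof (rule sum_norm_le)
      fix j assume "j \<in> {..<P}"
      then have "cmod (s * cnj ((w ^ j) ^ k)) * norm ((T ^^ n) (u j) - ((w ^ j) ^ n) *\<^sub>C u j) \<le> 1 * d"
        using uT[of j n] that s w[of j] by (intro mult_mono) (auto simp: norm_mult norm_power)
      then show "norm ((s * cnj ((w ^ j) ^ k)) *\<^sub>C ((T ^^ n) (u j) - ((w ^ j) ^ n) *\<^sub>C u j)) \<le> d"
        by (simp add: norm_scaleC)
    qed
    finally show ?thesis by simp
  qed
  have err: "cmod (cinner ((T ^^ n) (f 0 k)) y - cinner (f n k) y) \<le> \<delta>"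
    if "n \<le> R" "norm y \<le> B" for n k y
  proof -
    have "cmod (cinner ((T ^^ n) (f 0 k) - f n k) y) \<le> (real P * d) * B"
      using \<open>d > 0\<close> by (intro order_trans[OF norm_cinner_le] mult_mono fT that) auto
    also have "\<dots> = \<delta>" using B P by (simp add: d_def)
    finally show ?thesis by (simp add: cinner.diff_left)
  qed
  have norm_f: "norm (f 0 l) \<le> B" if "l < N" for l
    using norm_eq_sqrt_if_cinner_eq[of "f 0 l" 1] ff[of 0 l l] that B(1) by simp
  show ?thesis
  proof (intro exI[of _ "f 0"] conjI allI impI ballI)
    fix k l assume kl: "k < N" "l < N"
    show "cinner (f 0 k) (f 0 l) = (if k = l then 1 else 0)" using ff[of 0 k l] kl by simp
    show "cmod (cinner ((T ^^ n) (f 0 k)) (f 0 l) - (if k = l + n then 1 else 0)) \<le> \<delta>" if "n \<le> R" for n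
      using err[OF that norm_f, of l k] ff[OF that kl] kl by simp
  next
    fix k g assume "k < N" "g \<in> G"
    then show "cinner (f 0 k) g = 0" using fG by simp
    show "cmod (cinner ((T ^^ n) (f 0 k)) g) \<le> \<delta>" if "n \<le> R" for n
      using err[OF that B(2)[OF \<open>g \<in> G\<close>], of k] fG[OF \<open>g \<in> G\<close>] by simp
  qed
qed

section \<open>Averaging over time scales\<close>

text \<open>Blocks that work only for a finite time are added up, each of them good up to a time
  \<open>R\<close> beyond which the products of the earlier vectors have died out. Before \<open>R\<close> the new block \<open>v\<close> adds its
  share of the pattern. After \<open>R\<close> the old sum \<open>z\<close> is dead, and whatever \<open>v\<close> does, it is a single
  vector of norm 1: its products with \<open>z\<close> are at most \<open>M \<surd>s\<close>, by orthogonality and not just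
  \<open>M s\<close>. So the error of a sum of \<open>s\<close> blocks is of order \<open>\<surd>s\<close>
  at all times if \<open>\<delta>\<close> is of order \<open>1 / s\<close>.\<close>

lemma shift_block_sum:
  assumes "finite F" and "\<delta> > 0"
  shows "\<exists>z. (\<forall>k<N. \<forall>l<N. cinner (z k) (z l) = (if k = l then of_nat s else 0)) \<and>
    (\<forall>k<N. \<forall>f\<in>F. cinner (z k) f = 0) \<and>
    (\<forall>n. \<forall>k<N. \<forall>l<N. cmod (cinner ((T ^^ n) (z k)) (z l) - (if k = l + n then of_nat s else 0))
      \<le> 3 * \<delta> * real s + 2 * M * sqrt (real s) + M) \<and>
    (\<forall>n. \<forall>k<N. \<forall>f\<in>F. cmod (cinner ((T ^^ n) (z k)) f) \<le> real s * \<delta> + M * norm f \<and>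
      cmod (cinner ((T ^^ n) f) (z k)) \<le> real s * \<delta> + M * norm f)"
proof (induction s)
  case 0
  show ?case
    using M_ge_1 by (intro exI[of _ "\<lambda>_. 0"]) (simp add: cinner.zero_left cinner.zero_right
        linear_0[OF bounded_linear.linear[OF pow_linear]])
next
  case (Suc s)
  then obtain z where
    z: "(\<forall>k<N. \<forall>l<N. cinner (z k) (z l) = (if k = l then of_nat s else 0)) \<and>
    (\<forall>k<N. \<forall>f\<in>F. cinner (z k) f = 0) \<and>
    (\<forall>n. \<forall>k<N. \<forall>l<N. cmod (cinner ((T ^^ n) (z k)) (z l) - (if k = l + n then of_nat s else 0))
      \<le> 3 * \<delta> * real s + 2 * M * sqrt (real s) + M) \<and>
    (\<forall>n. \<forall>k<N. \<forall>f\<in>F. cmod (cinner ((T ^^ n) (z k)) f) \<le> real s * \<delta> + M * norm f \<and>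
      cmod (cinner ((T ^^ n) f) (z k)) \<le> real s * \<delta> + M * norm f)"
    by (elim exE)
  have zz: "cinner (z k) (z l) = (if k = l then of_nat s else 0)"
    and zT: "cmod (cinner ((T ^^ n) (z k)) (z l) - (if k = l + n then of_nat s else 0))
        \<le> 3 * \<delta> * real s + 2 * M * sqrt (real s) + M" if "k < N" "l < N" for n k l
    using z that by blast+
  have zF: "cinner (z k) f = 0"
    and zTF: "cmod (cinner ((T ^^ n) (z k)) f) \<le> real s * \<delta> + M * norm f"
    and zFT: "cmod (cinner ((T ^^ n) f) (z k)) \<le> real s * \<delta> + M * norm f"
    if "k < N" "f \<in> F" for n k f
    using z that by blast+
  have M: "M > 0" using M_ge_1 by simp
  have nz: "norm (z k) = sqrt (real s)" if "k < N" for k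
    using norm_eq_sqrt_if_cinner_eq[of "z k" "real s"] zz[OF that that] by simp
  define X where "X = F \<union> z ` {..<N}"
  have X: "finite X" using assms by (simp add: X_def)
  have "\<forall>\<^sub>F n in sequentially. \<forall>a\<in>X. \<forall>b\<in>X. cmod (cinner ((T ^^ n) a) b) < \<delta>"
    using X tendstoD[OF weakly_null \<open>\<delta> > 0\<close>] by (auto intro!: eventually_ball_finite)
  then obtain R0 where R0: "\<And>n a b. n \<ge> R0 \<Longrightarrow> a \<in> X \<Longrightarrow> b \<in> X \<Longrightarrow> cmod (cinner ((T ^^ n) a) b) < \<delta>"
    unfolding eventually_sequentially by blast
  \<comment> \<open>beyond \<open>N\<close> the shift pattern itself is 0\<close>
  define R where "R = max R0 N"
  have dead: "cmod (cinner ((T ^^ n) a) b) \<le> \<delta>" if "n > R" "a \<in> X" "b \<in> X" for n a b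
    using R0[of n a b] that by (simp add: R_def)
  \<comment> \<open>orthogonality to \<open>T\<^sup>n a\<close> takes care of the products with the new vectors on the right\<close>
  define G where "G = (\<lambda>(n, a). (T ^^ n) a) ` ({..R} \<times> X)"
  have G: "finite G" using X by (simp add: G_def)
  have inG: "(T ^^ n) a \<in> G" if "n \<le> R" "a \<in> X" for n a
    unfolding G_def using that by (intro image_eqI[of _ _ "(n, a)"]) auto
  have XG: "a \<in> G" if "a \<in> X" for a using inG[of 0 a] that by simp
  obtain v where
    v: "(\<forall>k<N. \<forall>l<N. cinner (v k) (v l) = (if k = l then 1 else 0)) \<and>
    (\<forall>k<N. \<forall>g\<in>G. cinner (v k) g = 0) \<and>
    (\<forall>n\<le>R. \<forall>k<N. \<forall>l<N. cmod (cinner ((T ^^ n) (v k)) (v l) - (if k = l + n then 1 else 0)) \<le> \<delta>) \<and>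
    (\<forall>n\<le>R. \<forall>k<N. \<forall>g\<in>G. cmod (cinner ((T ^^ n) (v k)) g) \<le> \<delta>)"
    using shift_block_finite_time[OF G \<open>\<delta> > 0\<close>, of N R] by (elim exE)
  have vv: "cinner (v k) (v l) = (if k = l then 1 else 0)" if "k < N" "l < N" for k l
    using v that by blast
  have vG: "cinner (v k) g = 0" if "k < N" "g \<in> G" for k g
    using v that by blast
  have vT: "cmod (cinner ((T ^^ n) (v k)) (v l) - (if k = l + n then 1 else 0)) \<le> \<delta>"
    if "n \<le> R" "k < N" "l < N" for n k l
    using v that by blast
  have vTG: "cmod (cinner ((T ^^ n) (v k)) g) \<le> \<delta>" if "n \<le> R" "k < N" "g \<in> G" for n k g
    using v that by blast
  have Gv: "cinner g (v k) = 0" if "k < N" "g \<in> G" for k g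
    using vG[OF that] by (subst cinner_commute) simp
  have nv: "norm (v k) = 1" if "k < N" for k
    using norm_eq_sqrt_if_cinner_eq[of "v k" 1] vv[OF that that] by simp
  have zX: "z k \<in> X" if "k < N" for k using that by (simp add: X_def)
  have FX: "f \<in> X" if "f \<in> F" for f using that by (simp add: X_def)
  have le: "cmod (cinner ((T ^^ n) x) y) \<le> M * (norm x * norm y)" for n x y
    using norm_cinner_le[of "(T ^^ n) x" y] mult_right_mono[OF power_bounded[of n x], of "norm y"]
    by (simp add: mult.assoc)
  have mono: "sqrt (real s) \<le> sqrt (real (Suc s))" by simp
  show ?case
  proof (intro exI[of _ "\<lambda>k. z k + v k"] conjI allI impI ballI)
    fix k l assume kl: "k < N" "l < N"
    show "cinner (z k + v k) (z l + v l) = (if k = l then of_nat (Suc s) else 0)"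
      using zz[OF kl] vv[OF kl] vG[OF kl(1) XG[OF zX[OF kl(2)]]] Gv[OF kl(2) XG[OF zX[OF kl(1)]]]
      by (simp add: cinner_add_left cinner_add_right)
    fix n
    let ?i = "if k = l + n then 1 else 0 :: complex"
    let ?B = "3 * \<delta> * real (Suc s) + 2 * M * sqrt (real (Suc s)) + M"
    define a b c d where "a = cinner ((T ^^ n) (z k)) (z l)" "b = cinner ((T ^^ n) (v k)) (z l)"
      "c = cinner ((T ^^ n) (z k)) (v l)" "d = cinner ((T ^^ n) (v k)) (v l)"
    note abcd = this
    have sum: "cinner ((T ^^ n) (z k + v k)) (z l + v l) = a + b + c + d"
      by (simp add: abcd pow_simps cinner_add_left cinner_add_right)
    show "cmod (cinner ((T ^^ n) (z k + v k)) (z l + v l) - (if k = l + n then of_nat (Suc s) else 0)) \<le> ?B"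
    proof (cases "n \<le> R")
      case True
      have "cmod ((a - of_nat s * ?i) + b + c + (d - ?i)) \<le>
          cmod (a - of_nat s * ?i) + cmod b + cmod c + cmod (d - ?i)"
        by (intro norm_triangle_le add_mono) auto
      moreover have "cmod (a - of_nat s * ?i) \<le> 3 * \<delta> * real s + 2 * M * sqrt (real s) + M"
        using zT[OF kl, of n] by (auto simp: abcd)
      moreover have "cmod b \<le> \<delta>" unfolding abcd by (intro vTG True kl XG zX)
      moreover have "c = 0" unfolding abcd by (intro Gv inG True kl zX)
      moreover have "cmod (d - ?i) \<le> \<delta>" unfolding abcd by (rule vT[OF True kl])
      moreover have "2 * M * sqrt (real s) \<le> 2 * M * sqrt (real (Suc s))"
        using M mono by (intro mult_left_mono) auto
      ultimately have "cmod ((a - of_nat s * ?i) + b + c + (d - ?i)) \<le> ?B"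
        using \<open>\<delta> > 0\<close> by (simp add: algebra_simps)
      then show ?thesis unfolding sum by (auto simp: algebra_simps)
    next
      case False
      then have n: "k \<noteq> l + n" using kl by (simp add: R_def)
      have "cmod (a + b + c + d) \<le> cmod a + cmod b + cmod c + cmod d"
        by (intro norm_triangle_le add_mono) auto
      moreover have "cmod a \<le> \<delta>" unfolding abcd using False by (intro dead zX kl) auto
      moreover have "cmod b \<le> M * sqrt (real s)" "cmod c \<le> M * sqrt (real s)" "cmod d \<le> M"
        unfolding abcd using le[of n "v k" "z l"] le[of n "z k" "v l"] le[of n "v k" "v l"] kl
        by (simp_all add: nz nv)
      moreover have "M * sqrt (real s) \<le> M * sqrt (real (Suc s))"
        using M mono by (intro mult_left_mono) auto
      moreover have "\<delta> * real s \<ge> 0" using \<open>\<delta> > 0\<close> by simp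
      moreover have "?B = 3 * (\<delta> * real s) + 3 * \<delta> + 2 * (M * sqrt (real (Suc s))) + M"
        by (simp add: algebra_simps)
      ultimately have "cmod (a + b + c + d) \<le> ?B"
        using \<open>\<delta> > 0\<close> by linarith
      then show ?thesis unfolding sum using n by simp
    qed
  next
    fix k f assume kf: "k < N" "f \<in> F"
    show "cinner (z k + v k) f = 0"
      using zF[OF kf] vG[OF kf(1) XG[OF FX[OF kf(2)]]] by (simp add: cinner_add_left)
    fix n
    have s1: "cmod (cinner ((T ^^ n) (z k + v k)) f) \<le>
        cmod (cinner ((T ^^ n) (z k)) f) + cmod (cinner ((T ^^ n) (v k)) f)"
      by (simp add: pow_simps cinner_add_left norm_triangle_ineq)
    have s2: "cmod (cinner ((T ^^ n) f) (z k + v k)) \<le>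
        cmod (cinner ((T ^^ n) f) (z k)) + cmod (cinner ((T ^^ n) f) (v k))"
      by (simp add: pow_simps cinner_add_right norm_triangle_ineq)
    have "\<delta> * real s \<ge> 0" using \<open>\<delta> > 0\<close> by simp
    have sd: "real (Suc s) * \<delta> = \<delta> * real s + \<delta>" by (simp add: algebra_simps)
    show "cmod (cinner ((T ^^ n) (z k + v k)) f) \<le> real (Suc s) * \<delta> + M * norm f"
    proof (cases "n \<le> R")
      case True
      show ?thesis
        using s1 zTF[OF kf, of n] vTG[OF True kf(1) XG[OF FX[OF kf(2)]]] by (simp add: algebra_simps)
    next
      case False
      then show ?thesis
        using s1 dead[of n "z k" f] zX[OF kf(1)] FX[OF kf(2)] le[of n "v k" f] nv[OF kf(1)]
          \<open>\<delta> * real s \<ge> 0\<close> unfolding sd by simp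
    qed
    show "cmod (cinner ((T ^^ n) f) (z k + v k)) \<le> real (Suc s) * \<delta> + M * norm f"
    proof (cases "n \<le> R")
      case True
      show ?thesis
        using s2 zFT[OF kf, of n] Gv[OF kf(1) inG[OF True FX[OF kf(2)]]] \<open>\<delta> > 0\<close>
        by (simp add: algebra_simps)
    next
      case False
      then show ?thesis
        using s2 dead[of n f "z k"] zX[OF kf(1)] FX[OF kf(2)] le[of n f "v k"] nv[OF kf(1)]
          \<open>\<delta> * real s \<ge> 0\<close> unfolding sd by simp
    qed
  qed
qed

text \<open>Dividing a sum of \<open>s\<close> blocks by \<open>\<surd>s\<close> normalizes it. Its own products then carry an error of order
  \<open>1 / \<surd>s\<close>, and so do those with a fixed vector, because only one block at a time
  is uncontrolled against it.\<close>

lemma shift_block: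
  assumes "finite F" and "\<epsilon> > 0"
  shows "\<exists>w. (\<forall>k<N. \<forall>l<N. cinner (w k) (w l) = (if k = l then 1 else 0)) \<and>
    (\<forall>k<N. \<forall>f\<in>F. cinner (w k) f = 0) \<and>
    (\<forall>n. \<forall>k<N. \<forall>l<N. cmod (cinner ((T ^^ n) (w k)) (w l) - (if k = l + n then 1 else 0)) \<le> \<epsilon>) \<and>
    (\<forall>n. \<forall>k<N. \<forall>f\<in>F. cmod (cinner ((T ^^ n) (w k)) f) \<le> \<epsilon> \<and>
      cmod (cinner ((T ^^ n) f) (w k)) \<le> \<epsilon>)"
proof -
  have M: "M \<ge> 1" by (rule M_ge_1)
  obtain B where B: "B \<ge> 1" "\<And>f. f \<in> F \<Longrightarrow> norm f \<le> B"
  proof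
    show "1 + (\<Sum>f\<in>F. norm f) \<ge> 1" by (simp add: sum_nonneg)
    show "norm f \<le> 1 + (\<Sum>f\<in>F. norm f)" if "f \<in> F" for f
      using member_le_sum[of f F norm] that \<open>finite F\<close> by simp
  qed
  \<comment> \<open>\<open>c / \<surd>s\<close> bounds all errors of the normalized sum when \<open>\<delta> = 1 / s\<close>\<close>
  define c where "c = 3 + 3 * M * B"
  have MB: "M \<le> M * B" "0 < M * B" using B M by simp_all
  have c: "c > 0" "3 + 3 * M \<le> c" "1 + M * B \<le> c" using MB unfolding c_def by linarith+
  define s where "s = Suc (nat \<lceil>(c / \<epsilon>)\<^sup>2\<rceil>)"
  define q where "q = sqrt (real s)"
  have s: "s > 0" by (simp add: s_def)
  have q: "q \<ge> 1" "q * q = real s" using s by (simp_all add: q_def)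
  have "(c / \<epsilon>)\<^sup>2 \<le> real s"
    using real_nat_ceiling_ge[of "(c / \<epsilon>)\<^sup>2"] unfolding s_def of_nat_Suc by linarith
  then have "(c / \<epsilon>)\<^sup>2 \<le> q\<^sup>2" by (simp add: q_def)
  then have "c / \<epsilon> \<le> q" by (rule power2_le_imp_le) (simp add: q_def)
  then have cq: "c \<le> \<epsilon> * q" using \<open>\<epsilon> > 0\<close> by (simp add: divide_le_eq mult.commute)
  define \<delta> where "\<delta> = 1 / real s"
  have \<delta>: "\<delta> > 0" "real s * \<delta> = 1" using s by (simp_all add: \<delta>_def)
  obtain z where
    z: "(\<forall>k<N. \<forall>l<N. cinner (z k) (z l) = (if k = l then of_nat s else 0)) \<and>
    (\<forall>k<N. \<forall>f\<in>F. cinner (z k) f = 0) \<and>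
    (\<forall>n. \<forall>k<N. \<forall>l<N. cmod (cinner ((T ^^ n) (z k)) (z l) - (if k = l + n then of_nat s else 0))
      \<le> 3 * \<delta> * real s + 2 * M * sqrt (real s) + M) \<and>
    (\<forall>n. \<forall>k<N. \<forall>f\<in>F. cmod (cinner ((T ^^ n) (z k)) f) \<le> real s * \<delta> + M * norm f \<and>
      cmod (cinner ((T ^^ n) f) (z k)) \<le> real s * \<delta> + M * norm f)"
    using shift_block_sum[OF \<open>finite F\<close> \<delta>(1), of N s] by (elim exE)
  have zz: "cinner (z k) (z l) = (if k = l then of_nat s else 0)"
    and zT: "cmod (cinner ((T ^^ n) (z k)) (z l) - (if k = l + n then of_nat s else 0))
        \<le> 3 * \<delta> * real s + 2 * M * sqrt (real s) + M" if "k < N" "l < N" for n k l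
    using z that by blast+
  have zF: "cinner (z k) f = 0"
    and zTF: "cmod (cinner ((T ^^ n) (z k)) f) \<le> real s * \<delta> + M * norm f"
    and zFT: "cmod (cinner ((T ^^ n) f) (z k)) \<le> real s * \<delta> + M * norm f"
    if "k < N" "f \<in> F" for n k f
    using z that by blast+
  have Tw: "(T ^^ n) ((1 / q) *\<^sub>R x) = (1 / q) *\<^sub>R (T ^^ n) x" for n x
    by (simp add: linear_simps[OF pow_linear])
  have ww: "cinner ((1 / q) *\<^sub>R x) ((1 / q) *\<^sub>R y) = (1 / real s) *\<^sub>R cinner x y" for x y :: 'a
    by (simp add: cinner_scaleR_left cinner_scaleR_right flip: q(2))
  have fin: "(1 / q) * x \<le> \<epsilon>" if "x \<le> c" for x
    using that cq q(1) by (simp add: divide_le_eq mult.commute)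
  show ?thesis
  proof (intro exI[of _ "\<lambda>k. (1 / q) *\<^sub>R z k"] conjI allI impI ballI)
    fix k l assume kl: "k < N" "l < N"
    show "cinner ((1 / q) *\<^sub>R z k) ((1 / q) *\<^sub>R z l) = (if k = l then 1 else 0)"
      unfolding ww zz[OF kl] using s by (simp add: scaleR_conv_of_real)
    fix n
    have "cinner ((T ^^ n) ((1 / q) *\<^sub>R z k)) ((1 / q) *\<^sub>R z l) - (if k = l + n then 1 else 0) =
        (1 / real s) *\<^sub>R (cinner ((T ^^ n) (z k)) (z l) - (if k = l + n then of_nat s else 0))"
      unfolding Tw ww using s by (simp add: scaleR_conv_of_real field_simps)
    also have "cmod \<dots> \<le> (1 / real s) * (3 * \<delta> * real s + 2 * M * sqrt (real s) + M)"
      unfolding norm_scaleR using zT[OF kl, of n] by (simp add: divide_right_mono)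
    also have "\<dots> = (1 / real s) * (3 + 2 * M * q + M)"
      using \<delta>(2) by (simp add: q_def mult.commute)
    also have "\<dots> \<le> (1 / real s) * (3 * q + 2 * M * q + M * q)"
      using q(1) M by (intro mult_left_mono add_mono) auto
    also have "\<dots> = (1 / q) * (3 + 3 * M)"
      using q(1) by (simp add: field_simps flip: q(2))
    also have "\<dots> \<le> \<epsilon>" by (rule fin[OF c(2)])
    finally show "cmod (cinner ((T ^^ n) ((1 / q) *\<^sub>R z k)) ((1 / q) *\<^sub>R z l)
        - (if k = l + n then 1 else 0)) \<le> \<epsilon>" .
  next
    fix k f assume kf: "k < N" "f \<in> F"
    show "cinner ((1 / q) *\<^sub>R z k) f = 0" using zF[OF kf] by (simp add: cinner_scaleR_left)
    fix n
    have bd: "(1 / q) * x \<le> \<epsilon>" if "x \<le> real s * \<delta> + M * norm f" for x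
    proof (rule fin)
      have "M * norm f \<le> M * B" using M B(2)[OF kf(2)] by (intro mult_left_mono) auto
      then show "x \<le> c" using that \<delta>(2) c(3) by simp
    qed
    show "cmod (cinner ((T ^^ n) ((1 / q) *\<^sub>R z k)) f) \<le> \<epsilon>"
      using bd[OF zTF[OF kf, of n]] q(1) by (simp add: Tw cinner_scaleR_left)
    show "cmod (cinner ((T ^^ n) f) ((1 / q) *\<^sub>R z k)) \<le> \<epsilon>"
      using bd[OF zFT[OF kf, of n]] q(1) by (simp add: cinner_scaleR_right)
  qed
qed

lemma shift_block_sequence:
  fixes \<epsilon> :: "nat \<Rightarrow> real"
  assumes "\<And>m. \<epsilon> m > 0"
  shows "\<exists>w. \<forall>m m'. \<forall>k<N. \<forall>l<N.
    cinner (w m k) (w m' l) = (if m = m' \<and> k = l then 1 else 0) \<and>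
    (\<forall>n. cmod (cinner ((T ^^ n) (w m k)) (w m' l) - (if m = m' \<and> k = l + n then 1 else 0))
      \<le> \<epsilon> (max m m'))"
proof -
  let ?P = "\<lambda>(w :: nat \<Rightarrow> nat \<Rightarrow> 'a) m v.
    (\<forall>k<N. \<forall>l<N. cinner (v k) (v l) = (if k = l then 1 else 0)) \<and>
    (\<forall>k<N. \<forall>f\<in>(\<Union>m'<m. w m' ` {..<N}). cinner (v k) f = 0) \<and>
    (\<forall>n. \<forall>k<N. \<forall>l<N. cmod (cinner ((T ^^ n) (v k)) (v l) - (if k = l + n then 1 else 0)) \<le> \<epsilon> m) \<and>
    (\<forall>n. \<forall>k<N. \<forall>f\<in>(\<Union>m'<m. w m' ` {..<N}). cmod (cinner ((T ^^ n) (v k)) f) \<le> \<epsilon> m \<and>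
      cmod (cinner ((T ^^ n) f) (v k)) \<le> \<epsilon> m)"
  have "\<exists>w. \<forall>m. ?P w m (w m)"
  proof (rule dependent_wellorder_choice)
    fix v :: "nat \<Rightarrow> 'a" and w w' :: "nat \<Rightarrow> nat \<Rightarrow> 'a" and m :: nat
    assume "\<And>m'. m' < m \<Longrightarrow> w m' = w' m'"
    then have "(\<Union>m'<m. w m' ` {..<N}) = (\<Union>m'<m. w' m' ` {..<N})" by auto
    then show "?P w m v = ?P w' m v" by simp
  next
    fix m and w :: "nat \<Rightarrow> nat \<Rightarrow> 'a"
    show "\<exists>v. ?P w m v" by (rule shift_block) (auto simp: assms)
  qed
  then obtain w where "\<forall>m. ?P w m (w m)" by (elim exE)
  note w = spec[OF this]
  have same: "cinner (w m k) (w m l) = (if k = l then 1 else 0)"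
    "cmod (cinner ((T ^^ n) (w m k)) (w m l) - (if k = l + n then 1 else 0)) \<le> \<epsilon> m"
    if "k < N" "l < N" for m n k l
    using conjunct1[OF w[of m], rule_format, OF that]
      conjunct1[OF conjunct2[OF conjunct2[OF w[of m]]], rule_format, OF that, of n] by blast+
  have earlier: "cinner (w m k) (w m' l) = 0" "cmod (cinner ((T ^^ n) (w m k)) (w m' l)) \<le> \<epsilon> m"
    "cmod (cinner ((T ^^ n) (w m' l)) (w m k)) \<le> \<epsilon> m"
    if "k < N" "l < N" "m' < m" for m m' n k l
  proof -
    have "w m' l \<in> (\<Union>m'<m. w m' ` {..<N})" using that by blast
    then show "cinner (w m k) (w m' l) = 0" "cmod (cinner ((T ^^ n) (w m k)) (w m' l)) \<le> \<epsilon> m"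
      "cmod (cinner ((T ^^ n) (w m' l)) (w m k)) \<le> \<epsilon> m"
      using conjunct1[OF conjunct2[OF w[of m]], rule_format, OF that(1)]
        conjunct2[OF conjunct2[OF conjunct2[OF w[of m]]], rule_format, OF that(1)] by blast+
  qed
  have later: "cinner (w m' l) (w m k) = 0" if "k < N" "l < N" "m' < m" for m m' k l
    using earlier(1)[OF that] by (subst cinner_commute) simp
  show ?thesis
  proof (intro exI[of _ w] allI impI)
    fix m m' k l assume kl: "k < N" "l < N"
    show "cinner (w m k) (w m' l) = (if m = m' \<and> k = l then 1 else 0) \<and>
      (\<forall>n. cmod (cinner ((T ^^ n) (w m k)) (w m' l) - (if m = m' \<and> k = l + n then 1 else 0))
        \<le> \<epsilon> (max m m'))"
    proof (cases m m' rule: linorder_cases)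
      case equal
      then show ?thesis using same[OF kl] by simp
    next
      case less
      then show ?thesis using earlier(3)[OF kl(2,1)] later[OF kl(2,1)] by (simp add: max_def)
    next
      case greater
      then show ?thesis using earlier(1,2)[OF kl] by (simp add: max_def)
    qed
  qed
qed

end

section \<open>Isometries from the shift model\<close>

text \<open>Distinct blocks are orthogonal, so the partial sums of the Parseval identity control both the
  convergence of the expansion and its inner products.\<close>

lemma isometry_of_functionals:
  fixes w :: "nat \<Rightarrow> nat \<Rightarrow> 'a::chilbert_space" and \<psi> :: "nat \<Rightarrow> nat \<Rightarrow> 'b::complex_inner \<Rightarrow> complex"
  assumes orth: "\<And>m m' k l. k < K \<Longrightarrow> l < K \<Longrightarrow>
      cinner (w m k) (w m' l) = (if m = m' \<and> k = l then 1 else 0)"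
    and add: "\<And>m k x y. \<psi> m k (x + y) = \<psi> m k x + \<psi> m k y"
    and scale: "\<And>m k c x. \<psi> m k (c *\<^sub>C x) = c * \<psi> m k x"
    and parseval: "\<And>x y. (\<lambda>m. \<Sum>k<K. \<psi> m k x * cnj (\<psi> m k y)) sums cinner x y"
  shows "\<exists>V. bounded_clinear V \<and> (\<forall>x y. cinner (V x) (V y) = cinner x y) \<and>
    (\<forall>x. (\<lambda>m. \<Sum>k<K. \<psi> m k x *\<^sub>C w m k) sums V x)"
proof -
  define b where "b x m = (\<Sum>k<K. \<psi> m k x *\<^sub>C w m k)" for x m
  have bb: "cinner (\<Sum>m\<in>S. b x m) (\<Sum>m\<in>S. b y m) = (\<Sum>m\<in>S. \<Sum>k<K. \<psi> m k x * cnj (\<psi> m k y))"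
    if "finite S" for S x y
    unfolding b_def using orth that by (rule cinner_sum_blocks)
  define V where "V x = suminf (b x)" for x
  have "summable (b x)" for x
    unfolding summable_Cauchy
  proof (intro allI impI)
    fix e :: real assume "e > 0"
    define g where "g m = (\<Sum>k<K. \<psi> m k x * cnj (\<psi> m k x))" for m
    have "summable g" using parseval[of x x] unfolding g_def by (rule sums_summable)
    moreover have "e\<^sup>2 > 0" using \<open>e > 0\<close> by simp
    ultimately obtain N where N: "\<And>m n. m \<ge> N \<Longrightarrow> norm (sum g {m..<n}) < e\<^sup>2"
      unfolding summable_Cauchy by blast
    have "norm (sum (b x) {m..<n}) < e" if "m \<ge> N" for m n
    proof -
      have "complex_of_real ((norm (sum (b x) {m..<n}))\<^sup>2) = sum g {m..<n}"
        using bb[of "{m..<n}" x x] unfolding cinner_self g_def by simp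
      then have "cmod (complex_of_real ((norm (sum (b x) {m..<n}))\<^sup>2)) < e\<^sup>2"
        using N[OF that, of n] by simp
      then have "(norm (sum (b x) {m..<n}))\<^sup>2 < e\<^sup>2"
        unfolding norm_of_real by simp
      then show ?thesis
        using \<open>e > 0\<close> by (simp add: power2_less_imp_less)
    qed
    then show "\<exists>N. \<forall>m\<ge>N. \<forall>n. norm (sum (b x) {m..<n}) < e" by blast
  qed
  then have V: "b x sums V x" for x unfolding V_def by (rule summable_sums)
  have iso: "cinner (V x) (V y) = cinner x y" for x y
  proof (rule LIMSEQ_unique)
    show "(\<lambda>p. cinner (\<Sum>m<p. b x m) (\<Sum>m<p. b y m)) \<longlonglongrightarrow> cinner (V x) (V y)"
      using V unfolding sums_def by (intro cinner.tendsto)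
    show "(\<lambda>p. cinner (\<Sum>m<p. b x m) (\<Sum>m<p. b y m)) \<longlonglongrightarrow> cinner x y"
      using parseval[of x y] unfolding sums_def by (simp only: bb finite_lessThan)
  qed
  have Vadd: "V (x + y) = V x + V y" for x y
  proof (rule sums_unique2[OF V])
    have "b (x + y) = (\<lambda>m. b x m + b y m)"
      by (simp add: b_def fun_eq_iff add scaleC_add_left sum.distrib)
    then show "b (x + y) sums (V x + V y)" using sums_add[OF V V] by simp
  qed
  have Vscale: "V (c *\<^sub>C x) = c *\<^sub>C V x" for c x
  proof (rule sums_unique2[OF V])
    have "b (c *\<^sub>C x) = (\<lambda>m. c *\<^sub>C b x m)"
      by (simp add: b_def fun_eq_iff scale scaleC_scaleC scaleC.sum_right)
    then show "b (c *\<^sub>C x) sums (c *\<^sub>C V x)"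
      using bounded_linear.sums[OF scaleC.bounded_linear_right V] by simp
  qed
  have "norm (V x) = norm x" for x
    unfolding norm_eq_sqrt_cinner iso ..
  then have "bounded_linear V"
    by (intro bounded_linear_intro[where K = 1]) (simp_all add: Vadd Vscale scaleR_scaleC)
  then show ?thesis
    using Vscale iso V unfolding bounded_clinear_def b_def by blast
qed

lemma cmod_le_norm_if_parseval:
  fixes \<psi> :: "nat \<Rightarrow> nat \<Rightarrow> complex"
  assumes parseval: "(\<lambda>m. \<Sum>k<K. \<psi> m k * cnj (\<psi> m k)) sums cinner x x" and "k < K"
  shows "cmod (\<psi> m k) \<le> norm x"
proof -
  have eq: "Re (\<Sum>k<K. \<psi> m k * cnj (\<psi> m k)) = (\<Sum>k<K. (cmod (\<psi> m k))\<^sup>2)" for m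
    by (simp add: complex_norm_square[symmetric] del: of_real_power)
  have s: "(\<lambda>m. \<Sum>k<K. (cmod (\<psi> m k))\<^sup>2) sums (norm x)\<^sup>2"
    using sums_Re[OF parseval] unfolding eq cinner_self Re_complex_of_real .
  have "(cmod (\<psi> m k))\<^sup>2 \<le> (\<Sum>k<K. (cmod (\<psi> m k))\<^sup>2)"
    using \<open>k < K\<close> by (intro member_le_sum) auto
  also have "\<dots> \<le> (norm x)\<^sup>2"
    using sum_le_suminf[OF sums_summable[OF s], of "{m}"] sums_unique[OF s] by (simp add: sum_nonneg)
  finally show ?thesis by (rule power2_le_imp_le) simp
qed

text \<open>The Cauchy--Schwarz inequality in the form needed when two different families of functionals meet.\<close>

lemma cross_sum_bound:
  assumes a: "(\<lambda>m. a m * cnj (a m)) sums complex_of_real (A\<^sup>2)"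
    and b: "(\<lambda>m. b m * cnj (b m)) sums complex_of_real (B\<^sup>2)" and "A \<ge> 0" "B \<ge> 0"
  shows "\<exists>s. (\<lambda>m. a m * cnj (b m)) sums s \<and> cmod s \<le> A * B"
proof -
  have *: "Re (z * cnj z) = (cmod z)\<^sup>2" for z :: complex
    by (simp add: complex_norm_square[symmetric] del: of_real_power)
  have a': "(\<lambda>m. (cmod (a m))\<^sup>2) sums A\<^sup>2" and b': "(\<lambda>m. (cmod (b m))\<^sup>2) sums B\<^sup>2"
    using sums_Re[OF a] sums_Re[OF b] by (simp_all only: * Re_complex_of_real)
  have "summable (\<lambda>m. a m * cnj (b m))"
  proof (rule summable_comparison_test')
    show "summable (\<lambda>m. (cmod (a m))\<^sup>2 + (cmod (b m))\<^sup>2)"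
      using a' b' by (intro summable_add) (auto dest: sums_summable)
    fix m
    have "2 * (cmod (a m) * cmod (b m)) \<le> (cmod (a m))\<^sup>2 + (cmod (b m))\<^sup>2"
      using sum_squares_bound[of "cmod (a m)" "cmod (b m)"] by simp
    moreover have "0 \<le> cmod (a m) * cmod (b m)" by simp
    ultimately show "norm (a m * cnj (b m)) \<le> (cmod (a m))\<^sup>2 + (cmod (b m))\<^sup>2"
      unfolding norm_mult complex_mod_cnj by linarith
  qed
  then have s: "(\<lambda>m. a m * cnj (b m)) sums (\<Sum>m. a m * cnj (b m))" by (rule summable_sums)
  have "cmod (\<Sum>m<n. a m * cnj (b m)) \<le> A * B" for n
  proof (rule power2_le_imp_le)
    have "cmod (\<Sum>m<n. a m * cnj (b m)) \<le> (\<Sum>m<n. cmod (a m) * cmod (b m))"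
      by (intro sum_norm_le) (simp add: norm_mult)
    then have "(cmod (\<Sum>m<n. a m * cnj (b m)))\<^sup>2 \<le> (\<Sum>m<n. cmod (a m) * cmod (b m))\<^sup>2"
      by (intro power_mono) auto
    also have "\<dots> \<le> (\<Sum>m<n. (cmod (a m))\<^sup>2) * (\<Sum>m<n. (cmod (b m))\<^sup>2)"
      by (rule Cauchy_Schwarz_ineq_sum)
    also have "\<dots> \<le> A\<^sup>2 * B\<^sup>2"
    proof (rule mult_mono)
      show "(\<Sum>m<n. (cmod (a m))\<^sup>2) \<le> A\<^sup>2"
        using sum_le_suminf[OF sums_summable[OF a'], of "{..<n}"] sums_unique[OF a'] by simp
      show "(\<Sum>m<n. (cmod (b m))\<^sup>2) \<le> B\<^sup>2"
        using sum_le_suminf[OF sums_summable[OF b'], of "{..<n}"] sums_unique[OF b'] by simp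
    qed (simp_all add: sum_nonneg)
    finally show "(cmod (\<Sum>m<n. a m * cnj (b m)))\<^sup>2 \<le> (A * B)\<^sup>2"
      by (simp add: power_mult_distrib)
  qed (use assms in simp)
  then have "cmod (\<Sum>m. a m * cnj (b m)) \<le> A * B"
    using s unfolding sums_def by (intro LIMSEQ_le_const2[OF tendsto_norm]) auto
  then show ?thesis using s by blast
qed

text \<open>Tannery's theorem, applied to the inner and then to the outer series.\<close>

lemma dominated_double_series:
  fixes e :: "nat \<Rightarrow> nat \<Rightarrow> nat \<Rightarrow> real"
  assumes nonneg: "\<And>n m m'. 0 \<le> e n m m'" and bd: "\<And>n m m'. e n m m' \<le> c m * c m'"
    and c: "\<And>m. 0 \<le> c m" "summable c" and lim: "\<And>m m'. (\<lambda>n. e n m m') \<longlonglongrightarrow> 0"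
  shows "\<exists>E. E \<longlonglongrightarrow> 0 \<and> (\<forall>n. 0 \<le> E n \<and> E n \<le> (suminf c)\<^sup>2) \<and>
    (\<forall>n p. (\<Sum>m<p. \<Sum>m'<p. e n m m') \<le> E n)"
proof -
  define e1 where "e1 n m = (\<Sum>m'. e n m m')" for n m
  have cc: "summable (\<lambda>m'. c m * c m')" for m using c(2) by (rule summable_mult)
  have s: "summable (e n m)" for n m
    using nonneg bd by (intro summable_comparison_test'[OF cc[of m]]) simp
  have e1_nonneg: "0 \<le> e1 n m" for n m
    unfolding e1_def by (intro suminf_nonneg s nonneg)
  have e1_le: "e1 n m \<le> c m * suminf c" for n m
    unfolding e1_def suminf_mult[OF c(2), symmetric] by (intro suminf_le s cc bd)
  have cS: "summable (\<lambda>m. c m * suminf c)" using c(2) by (rule summable_mult2)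
  have s1: "summable (e1 n)" for n
    using e1_nonneg e1_le by (intro summable_comparison_test'[OF cS]) simp
  have lim1: "(\<lambda>n. e1 n m) \<longlonglongrightarrow> 0" for m
    using tannerys_theorem[of "\<lambda>k n. e n m k" "\<lambda>_. 0" sequentially "\<lambda>k. c m * c k"]
      lim cc nonneg bd unfolding e1_def by (simp add: always_eventually split_beta)
  have "(\<lambda>n. \<Sum>m. e1 n m) \<longlonglongrightarrow> 0"
    using tannerys_theorem[of "\<lambda>k n. e1 n k" "\<lambda>_. 0" sequentially "\<lambda>k. c k * suminf c"]
      lim1 cS e1_nonneg e1_le by (simp add: always_eventually split_beta)
  moreover have "0 \<le> (\<Sum>m. e1 n m)" for n
    by (intro suminf_nonneg s1 e1_nonneg)
  moreover have "(\<Sum>m. e1 n m) \<le> (suminf c)\<^sup>2" for n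
    unfolding power2_eq_square suminf_mult2[OF c(2)] by (intro suminf_le s1 cS e1_le)
  moreover have "(\<Sum>m<p. \<Sum>m'<p. e n m m') \<le> (\<Sum>m. e1 n m)" for n p
  proof -
    have "(\<Sum>m<p. \<Sum>m'<p. e n m m') \<le> (\<Sum>m<p. e1 n m)"
      unfolding e1_def by (intro sum_mono sum_le_suminf s) (auto intro: nonneg)
    also have "\<dots> \<le> (\<Sum>m. e1 n m)"
      by (intro sum_le_suminf s1) (auto intro: e1_nonneg)
    finally show ?thesis .
  qed
  ultimately show ?thesis by blast
qed

lemma sum_shifted_diagonal:
  fixes f :: "nat \<Rightarrow> nat \<Rightarrow> 'a::comm_monoid_add"
  shows "(\<Sum>k<K. \<Sum>l<K. if k = l + n then f k l else 0) = (\<Sum>l<K - n. f (l + n) l)"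
proof -
  have "(\<Sum>k<K. \<Sum>l<K. if k = l + n then f k l else 0) =
      (\<Sum>l<K. \<Sum>k<K. if k = l + n then f k l else 0)"
    by (rule sum.swap)
  also have "\<dots> = (\<Sum>l<K. if l + n < K then f (l + n) l else 0)"
    by (intro sum.cong refl) (simp add: sum.delta)
  also have "\<dots> = (\<Sum>l\<in>{..<K} \<inter> {l. l + n < K}. f (l + n) l)"
    by (subst sum.inter_restrict) (auto intro!: sum.cong)
  also have "{..<K} \<inter> {l. l + n < K} = {..<K - n}" by auto
  finally show ?thesis .
qed

context circle_operator
begin

text \<open>Perturbed shift blocks act like exact ones on vectors with bounded coefficients. The error
  \<open>E n\<close> is uniform in the number \<open>p\<close> of blocks, which lets it pass to infinite expansions, and it
  tends to 0 because the errors of the individual products do and are dominated.\<close>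

lemma shift_model:
  assumes "K > 0" and "\<eta> > 0"
  shows "\<exists>(w :: nat \<Rightarrow> nat \<Rightarrow> 'a) E. (\<forall>m m'. \<forall>k<K. \<forall>l<K. cinner (w m k) (w m' l) = (if m = m' \<and> k = l then 1 else 0)) \<and>
    E \<longlonglongrightarrow> 0 \<and> (\<forall>n. 0 \<le> E n \<and> E n \<le> \<eta>) \<and>
    (\<forall>n p a b A B. (\<forall>m. \<forall>k<K. cmod (a m k) \<le> A) \<longrightarrow> (\<forall>m. \<forall>k<K. cmod (b m k) \<le> B) \<longrightarrow>
      cmod (cinner ((T ^^ n) (\<Sum>m<p. \<Sum>k<K. a m k *\<^sub>C w m k)) (\<Sum>m<p. \<Sum>k<K. b m k *\<^sub>C w m k) -
        (\<Sum>m<p. \<Sum>l<K - n. a m (l + n) * cnj (b m l))) \<le> E n * (A * B))"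
proof -
  \<comment> \<open>a block has \<open>K\<close> vectors, and \<open>4\<^bsup>-max(m,m')\<^esup> \<le> 2\<^bsup>-m\<^esup> 2\<^bsup>-m'\<^esup>\<close> separates the indices\<close>
  define \<epsilon> where "\<epsilon> m = \<eta> * (1 / 4) ^ Suc m / (real K)\<^sup>2" for m :: nat
  have K2: "(real K)\<^sup>2 > 0" using assms by simp
  have "\<epsilon> m > 0" for m using assms by (simp add: \<epsilon>_def)
  then obtain w where w: "\<forall>m m'. \<forall>k<K. \<forall>l<K.
      cinner (w m k) (w m' l) = (if m = m' \<and> k = l then 1 else 0) \<and>
      (\<forall>n. cmod (cinner ((T ^^ n) (w m k)) (w m' l) - (if m = m' \<and> k = l + n then 1 else 0))
        \<le> \<epsilon> (max m m'))"
    using shift_block_sequence[of \<epsilon> K] by blast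
  define D where "D n m m' k l =
    cinner ((T ^^ n) (w m k)) (w m' l) - (if m = m' \<and> k = l + n then 1 else 0)" for n m m' k l
  have D: "cmod (D n m m' k l) \<le> \<epsilon> (max m m')" if "k < K" "l < K" for n m m' k l
    using w that unfolding D_def by blast
  define e where "e n m m' = (\<Sum>k<K. \<Sum>l<K. cmod (D n m m' k l))" for n m m'
  define c where "c m = sqrt \<eta> * (1 / 2) ^ Suc m" for m :: nat
  have "e n m m' \<le> c m * c m'" for n m m'
  proof -
    have "e n m m' \<le> (\<Sum>k<K. \<Sum>l<K. \<epsilon> (max m m'))"
      unfolding e_def by (intro sum_mono D) auto
    also have "\<dots> = \<eta> * (1 / 4) ^ Suc (max m m')"
      using \<open>K > 0\<close> by (simp add: \<epsilon>_def power2_eq_square)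
    also have "(1 / 4 :: real) ^ Suc (max m m') = (1 / 2) ^ Suc (max m m') * (1 / 2) ^ Suc (max m m')"
      unfolding power_mult_distrib[symmetric] by simp
    also have "\<eta> * \<dots> \<le> \<eta> * ((1 / 2) ^ Suc m * (1 / 2) ^ Suc m')"
      using \<open>\<eta> > 0\<close> by (intro mult_left_mono mult_mono power_decreasing) auto
    also have "\<dots> = (sqrt \<eta> * sqrt \<eta>) * ((1 / 2) ^ Suc m * (1 / 2) ^ Suc m')"
      using \<open>\<eta> > 0\<close> by simp
    also have "\<dots> = c m * c m'" unfolding c_def by (simp only: mult_ac)
    finally show ?thesis .
  qed
  moreover have "0 \<le> e n m m'" for n m m' unfolding e_def by (intro sum_nonneg) auto
  moreover have "(\<lambda>n. e n m m') \<longlonglongrightarrow> 0" for m m'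
  proof -
    have "(\<lambda>n. cmod (D n m m' k l)) \<longlonglongrightarrow> 0" for k l
    proof -
      have "\<forall>\<^sub>F n in sequentially. cinner ((T ^^ n) (w m k)) (w m' l) = D n m m' k l"
        using eventually_gt_at_top[of k] by eventually_elim (simp add: D_def)
      then show ?thesis
        by (intro tendsto_norm_zero Lim_transform_eventually[OF weakly_null])
    qed
    then have "(\<lambda>n. e n m m') \<longlonglongrightarrow> (\<Sum>k<K. \<Sum>l<K. 0)"
      unfolding e_def by (intro tendsto_sum)
    then show ?thesis by simp
  qed
  moreover have "0 \<le> c m" for m using \<open>\<eta> > 0\<close> by (simp add: c_def)
  moreover have c: "c sums sqrt \<eta>"
    using sums_mult[OF power_half_series, of "sqrt \<eta>"] by (simp add: c_def[abs_def])
  then have "summable c" by (rule sums_summable)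
  ultimately obtain E where E: "E \<longlonglongrightarrow> 0" "\<And>n. 0 \<le> E n" "\<And>n. E n \<le> (suminf c)\<^sup>2"
    and eE: "\<And>n p. (\<Sum>m<p. \<Sum>m'<p. e n m m') \<le> E n"
    using dominated_double_series[of e c] by blast
  have "(suminf c)\<^sup>2 = \<eta>" unfolding sums_unique[OF c, symmetric] using \<open>\<eta> > 0\<close> by simp
  then have E\<eta>: "E n \<le> \<eta>" for n using E(3) by simp
  have "cmod (cinner ((T ^^ n) (\<Sum>m<p. \<Sum>k<K. a m k *\<^sub>C w m k)) (\<Sum>m<p. \<Sum>k<K. b m k *\<^sub>C w m k) -
      (\<Sum>m<p. \<Sum>l<K - n. a m (l + n) * cnj (b m l))) \<le> E n * (A * B)"
    if a: "\<forall>m. \<forall>k<K. cmod (a m k) \<le> A" and b: "\<forall>m. \<forall>k<K. cmod (b m k) \<le> B" for n p a b A B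
  proof -
    have AB: "0 \<le> A" "0 \<le> B"
      using a b \<open>K > 0\<close> norm_ge_zero order_trans by blast+
    have "cinner ((T ^^ n) (\<Sum>m<p. \<Sum>k<K. a m k *\<^sub>C w m k)) (\<Sum>m<p. \<Sum>k<K. b m k *\<^sub>C w m k) =
        (\<Sum>m<p. \<Sum>m'<p. \<Sum>k<K. \<Sum>l<K. a m k * cnj (b m' l) * cinner ((T ^^ n) (w m k)) (w m' l))"
      unfolding pow_simps cinner.sum_left[of _ "{..<p}"]
      unfolding cinner.sum_right[of _ _ "{..<p}"]
      unfolding cinner.sum_left[of _ "{..<K}"]
      unfolding cinner.sum_right[of _ _ "{..<K}"]
      by (simp only: cinner_scaleC_left cinner_scaleC_right mult.assoc) (simp only: mult.left_commute)
    moreover have "(\<Sum>m<p. \<Sum>l<K - n. a m (l + n) * cnj (b m l)) =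
        (\<Sum>m<p. \<Sum>m'<p. \<Sum>k<K. \<Sum>l<K. a m k * cnj (b m' l) * (if m = m' \<and> k = l + n then 1 else 0))"
    proof (rule sum.cong[OF refl])
      fix m assume m: "m \<in> {..<p}"
      have "(\<Sum>k<K. \<Sum>l<K. a m k * cnj (b m' l) * (if m = m' \<and> k = l + n then 1 else 0)) =
          (if m = m' then \<Sum>l<K - n. a m (l + n) * cnj (b m l) else 0)" for m'
      proof -
        have "(\<Sum>k<K. \<Sum>l<K. a m k * cnj (b m' l) * (if m = m' \<and> k = l + n then 1 else 0)) =
            (if m = m' then \<Sum>k<K. \<Sum>l<K. if k = l + n then a m k * cnj (b m l) else 0 else 0)"
          by (auto intro!: sum.cong sum.neutral)
        then show ?thesis by (simp only: sum_shifted_diagonal)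
      qed
      then show "(\<Sum>l<K - n. a m (l + n) * cnj (b m l)) =
          (\<Sum>m'<p. \<Sum>k<K. \<Sum>l<K. a m k * cnj (b m' l) * (if m = m' \<and> k = l + n then 1 else 0))"
        using m by simp
    qed
    ultimately have "cinner ((T ^^ n) (\<Sum>m<p. \<Sum>k<K. a m k *\<^sub>C w m k)) (\<Sum>m<p. \<Sum>k<K. b m k *\<^sub>C w m k) -
        (\<Sum>m<p. \<Sum>l<K - n. a m (l + n) * cnj (b m l)) =
        (\<Sum>m<p. \<Sum>m'<p. \<Sum>k<K. \<Sum>l<K. a m k * cnj (b m' l) * D n m m' k l)"
      unfolding D_def by (simp only: sum_subtractf[symmetric] right_diff_distrib[symmetric])
    also have "cmod \<dots> \<le> (\<Sum>m<p. \<Sum>m'<p. \<Sum>k<K. \<Sum>l<K. A * B * cmod (D n m m' k l))"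
      using a b AB by (intro sum_norm_le) (auto simp: norm_mult intro!: mult_right_mono mult_mono)
    also have "\<dots> = A * B * (\<Sum>m<p. \<Sum>m'<p. e n m m')"
      by (simp add: e_def sum_distrib_left)
    also have "\<dots> \<le> A * B * E n" using AB by (intro mult_left_mono eE) auto
    finally show ?thesis by (simp only: mult.commute)
  qed
  then show ?thesis using w E E\<eta> by (intro exI[of _ w] exI[of _ E]) auto
qed

text \<open>Level \<open>k < N\<close> of the blocks carries \<open>C\<^sup>k x\<close> measured in the defect form, level \<open>N\<close> carries
  \<open>C\<^sup>N x\<close> measured in the full inner product, so that the norms telescope to \<open>\<parallel>x\<parallel>\<^sup>2\<close>.\<close>

lemma isometric_model:
  fixes C :: "'b::complex_inner \<Rightarrow> 'b" and d :: "nat \<Rightarrow> 'b"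
  assumes C: "bounded_clinear C" and q: "0 \<le> q" "q < 1" and norm_C: "\<And>x. norm (C x) \<le> q * norm x"
    and dense: "closure (range d) = UNIV" and "\<eta> > 0"
  shows "\<exists>V E. bounded_clinear V \<and> (\<forall>x y. cinner (V x) (V y) = cinner x y) \<and>
    E \<longlonglongrightarrow> 0 \<and> (\<forall>n. 0 \<le> E n \<and> E n \<le> \<eta>) \<and>
    (\<forall>n\<ge>1. \<forall>x y. cmod (cinner ((T ^^ n) (V x)) (V y) - cinner ((C ^^ n) x) y)
      \<le> (E n + (if n \<le> N then 2 * q ^ N else q ^ n)) * (norm x * norm y))"
proof -
  define pw where "pw k = C ^^ k" for k
  have pw_add: "pw k (x + y) = pw k x + pw k y" for k x y
    using bounded_clinear_bounded_linear[OF bounded_clinear_pow[OF C]]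
    by (simp add: pw_def linear_simps)
  have pw_scale: "pw k (c *\<^sub>C x) = c *\<^sub>C pw k x" for k c x
    unfolding pw_def by (intro bounded_clinear_scaleC bounded_clinear_pow C)
  have pw_Suc: "C (pw k x) = pw (Suc k) x" for k x by (simp add: pw_def)
  have norm_pw: "norm (pw k x) \<le> q ^ k * norm x" for k x
  proof (induction k)
    case (Suc k)
    have "norm (pw (Suc k) x) \<le> q * norm (pw k x)" unfolding pw_Suc[symmetric] by (rule norm_C)
    also have "\<dots> \<le> q * (q ^ k * norm x)" using q(1) Suc by (intro mult_left_mono)
    finally show ?case by simp
  qed (simp add: pw_def)
  have norm_pw': "norm (pw k x) \<le> norm x" for k x
    using norm_pw[of k x] mult_right_mono[OF power_le_one[of q k], of "norm x"] q by simp

  define Q where "Q x y = cinner x y - cinner (C x) (C y)" for x y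
  have "pos_form Q"
    unfolding pos_form_def
  proof (intro conjI allI)
    fix x y z :: 'b and c
    have CC: "C (x + y) = C x + C y" "C (c *\<^sub>C x) = c *\<^sub>C C x"
      using pw_add[of 1] pw_scale[of 1] by (simp_all add: pw_def)
    show "Q (x + y) z = Q x z + Q y z" by (simp add: Q_def CC cinner_add_left)
    show "Q (c *\<^sub>C x) y = c * Q x y" by (simp add: Q_def CC cinner_scaleC_left right_diff_distrib)
    show "Q x y = cnj (Q y x)"
      unfolding Q_def complex_cnj_diff cinner_commute[symmetric] ..
    have "norm (C x) \<le> norm x" using norm_pw'[of 1 x] by (simp add: pw_def)
    then show "0 \<le> Re (Q x x)"
      unfolding Q_def cinner_self by (simp add: power_mono)
  qed
  moreover have "Re (Q x x) \<le> 1 * (norm x)\<^sup>2" for x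
    unfolding Q_def cinner_self by simp
  ultimately obtain \<phi> :: "nat \<Rightarrow> 'b \<Rightarrow> complex" where \<phi>:
    "\<And>m x y. \<phi> m (x + y) = \<phi> m x + \<phi> m y" "\<And>m c x. \<phi> m (c *\<^sub>C x) = c * \<phi> m x"
    "\<And>x y. (\<lambda>m. \<phi> m x * cnj (\<phi> m y)) sums Q x y"
    using pos_form_eq_suminf[of Q 1 d] dense by blast
  have "Re (cinner x x) \<le> 1 * (norm x)\<^sup>2" for x :: 'b
    unfolding cinner_self by simp
  then obtain \<theta> :: "nat \<Rightarrow> 'b \<Rightarrow> complex" where \<theta>:
    "\<And>m x y. \<theta> m (x + y) = \<theta> m x + \<theta> m y" "\<And>m c x. \<theta> m (c *\<^sub>C x) = c * \<theta> m x"
    "\<And>x y. (\<lambda>m. \<theta> m x * cnj (\<theta> m y)) sums cinner x y"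
    using pos_form_eq_suminf[of cinner 1 d] pos_form_cinner dense by blast

  define \<psi> where "\<psi> m k x = (if k < N then \<phi> m (pw k x) else \<theta> m (pw N x))" for m k x
  have \<psi>: "\<psi> m k (x + y) = \<psi> m k x + \<psi> m k y" "\<psi> m k (c *\<^sub>C x) = c * \<psi> m k x" for m k c x y
    by (simp_all add: \<psi>_def \<phi> \<theta> pw_add pw_scale)
  have telescope: "(\<Sum>l<r. Q (pw (l + n) x) (pw l y)) = cinner (pw n x) y - cinner (pw (r + n) x) (pw r y)"
    for r n x y
    by (induction r) (simp_all add: Q_def pw_Suc pw_def)
  have parseval: "(\<lambda>m. \<Sum>k<Suc N. \<psi> m k x * cnj (\<psi> m k y)) sums cinner x y" for x y
  proof -
    have "(\<lambda>m. (\<Sum>k<N. \<phi> m (pw k x) * cnj (\<phi> m (pw k y))) + \<theta> m (pw N x) * cnj (\<theta> m (pw N y)))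
        sums ((\<Sum>k<N. Q (pw k x) (pw k y)) + cinner (pw N x) (pw N y))"
      by (intro sums_add sums_sum \<phi> \<theta>)
    also have "(\<Sum>k<N. Q (pw k x) (pw k y)) + cinner (pw N x) (pw N y) = cinner x y"
      using telescope[where r = N and n = 0 and x = x and y = y] by (simp add: pw_def)
    finally show ?thesis by (simp add: \<psi>_def)
  qed
  have \<psi>_le: "\<forall>m. \<forall>k<Suc N. cmod (\<psi> m k x) \<le> norm x" for x
    using cmod_le_norm_if_parseval[of "\<lambda>m k. \<psi> m k x" "Suc N" x] parseval[of x x] by blast

  obtain w :: "nat \<Rightarrow> nat \<Rightarrow> 'a" and E where w: "\<forall>m m'. \<forall>k<Suc N. \<forall>l<Suc N.
      cinner (w m k) (w m' l) = (if m = m' \<and> k = l then 1 else 0)"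
    and E: "E \<longlonglongrightarrow> 0" "\<forall>n. 0 \<le> E n \<and> E n \<le> \<eta>"
    and wE: "\<forall>n p a b A B. (\<forall>m. \<forall>k<Suc N. cmod (a m k) \<le> A) \<longrightarrow> (\<forall>m. \<forall>k<Suc N. cmod (b m k) \<le> B) \<longrightarrow>
      cmod (cinner ((T ^^ n) (\<Sum>m<p. \<Sum>k<Suc N. a m k *\<^sub>C w m k)) (\<Sum>m<p. \<Sum>k<Suc N. b m k *\<^sub>C w m k) -
        (\<Sum>m<p. \<Sum>l<Suc N - n. a m (l + n) * cnj (b m l))) \<le> E n * (A * B)"
    using shift_model[OF zero_less_Suc \<open>\<eta> > 0\<close>, of N] by (elim exE conjE)
  obtain V where V: "bounded_clinear V" "\<forall>x y. cinner (V x) (V y) = cinner x y"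
    "\<And>x. (\<lambda>m. \<Sum>k<Suc N. \<psi> m k x *\<^sub>C w m k) sums V x"
    using isometry_of_functionals[of "Suc N" w \<psi>, OF w[rule_format] \<psi> parseval] by blast
  have near: "cmod (cinner ((T ^^ n) (V x)) (V y) - s) \<le> E n * (norm x * norm y)"
    if s: "(\<lambda>m. \<Sum>l<Suc N - n. \<psi> m (l + n) x * cnj (\<psi> m l y)) sums s" for n x y s
  proof (rule LIMSEQ_le_const2[OF tendsto_norm])
    show "(\<lambda>p. cinner ((T ^^ n) (\<Sum>m<p. \<Sum>k<Suc N. \<psi> m k x *\<^sub>C w m k))
        (\<Sum>m<p. \<Sum>k<Suc N. \<psi> m k y *\<^sub>C w m k) - (\<Sum>m<p. \<Sum>l<Suc N - n. \<psi> m (l + n) x * cnj (\<psi> m l y)))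
        \<longlonglongrightarrow> cinner ((T ^^ n) (V x)) (V y) - s"
      using V(3) s unfolding sums_def
      by (intro tendsto_diff cinner.tendsto bounded_linear.tendsto[OF pow_linear])
    show "\<exists>p0. \<forall>p\<ge>p0. cmod (cinner ((T ^^ n) (\<Sum>m<p. \<Sum>k<Suc N. \<psi> m k x *\<^sub>C w m k))
        (\<Sum>m<p. \<Sum>k<Suc N. \<psi> m k y *\<^sub>C w m k) - (\<Sum>m<p. \<Sum>l<Suc N - n. \<psi> m (l + n) x * cnj (\<psi> m l y)))
        \<le> E n * (norm x * norm y)"
      using wE[THEN spec[of _ n], THEN spec, THEN spec[of _ "\<lambda>m k. \<psi> m k x"],
          THEN spec[of _ "\<lambda>m k. \<psi> m k y"], THEN spec[of _ "norm x"], THEN spec[of _ "norm y"],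
          THEN mp, OF \<psi>_le, THEN mp, OF \<psi>_le] by (intro exI allI impI)
  qed
  have "cmod (cinner ((T ^^ n) (V x)) (V y) - cinner (pw n x) y)
      \<le> (E n + (if n \<le> N then 2 * q ^ N else q ^ n)) * (norm x * norm y)" if "n \<ge> 1" for n x y
  proof (cases "n \<le> N")
    case True
    have NN: "cmod (cinner (pw N x) (pw r y)) \<le> q ^ N * (norm x * norm y)" for r
    proof -
      have "norm (pw N x) * norm (pw r y) \<le> (q ^ N * norm x) * norm y"
        using q(1) by (intro mult_mono norm_pw norm_pw') auto
      then show ?thesis using norm_cinner_le[of "pw N x" "pw r y"] by (simp add: mult.assoc)
    qed
    \<comment> \<open>the one product of level \<open>N\<close> with a lower level, where the full form meets the defect form\<close>
    define b where "b = pw (N - n) y"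
    define \<beta> where "\<beta> = sqrt ((norm b)\<^sup>2 - (norm (C b))\<^sup>2)"
    have "norm (C b) \<le> norm b" using norm_pw'[of 1 b] by (simp add: pw_def)
    then have \<beta>: "0 \<le> \<beta>" "\<beta>\<^sup>2 = (norm b)\<^sup>2 - (norm (C b))\<^sup>2"
      by (simp_all add: \<beta>_def power_mono)
    have "\<beta>\<^sup>2 \<le> (norm b)\<^sup>2" unfolding \<beta> by simp
    then have "\<beta> \<le> norm b" by (rule power2_le_imp_le) simp
    also have "\<dots> \<le> norm y" unfolding b_def by (rule norm_pw')
    finally have "\<beta> \<le> norm y" .
    have sums_\<beta>: "(\<lambda>m. \<phi> m b * cnj (\<phi> m b)) sums complex_of_real (\<beta>\<^sup>2)"
      using \<phi>(3)[of b b] unfolding \<beta>(2) Q_def cinner_self by simp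
    have "(\<lambda>m. \<theta> m (pw N x) * cnj (\<theta> m (pw N x))) sums complex_of_real ((norm (pw N x))\<^sup>2)"
      using \<theta>(3)[of "pw N x" "pw N x"] unfolding cinner_self .
    then obtain s where s: "(\<lambda>m. \<theta> m (pw N x) * cnj (\<phi> m b)) sums s"
      and "cmod s \<le> norm (pw N x) * \<beta>"
      using cross_sum_bound[where a = "\<lambda>m. \<theta> m (pw N x)", OF _ sums_\<beta> norm_ge_zero \<beta>(1)] by blast
    note this(2)
    also have "norm (pw N x) * \<beta> \<le> (q ^ N * norm x) * norm y"
      using q(1) \<open>\<beta> \<le> norm y\<close> \<beta>(1) by (intro mult_mono norm_pw) auto
    finally have s_le: "cmod s \<le> q ^ N * (norm x * norm y)" by (simp only: mult.assoc)
    note s = s[unfolded b_def]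
    have "(\<lambda>m. (\<Sum>l<N - n. \<phi> m (pw (l + n) x) * cnj (\<phi> m (pw l y))) +
        \<theta> m (pw N x) * cnj (\<phi> m (pw (N - n) y)))
        sums ((\<Sum>l<N - n. Q (pw (l + n) x) (pw l y)) + s)"
      by (intro sums_add sums_sum \<phi> s)
    moreover have "(\<Sum>l<N - n. \<phi> m (pw (l + n) x) * cnj (\<phi> m (pw l y))) +
        \<theta> m (pw N x) * cnj (\<phi> m (pw (N - n) y)) = (\<Sum>l<Suc N - n. \<psi> m (l + n) x * cnj (\<psi> m l y))" for m
      using True \<open>n \<ge> 1\<close> by (auto simp: Suc_diff_le \<psi>_def intro!: sum.cong)
    ultimately have "(\<lambda>m. \<Sum>l<Suc N - n. \<psi> m (l + n) x * cnj (\<psi> m l y))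
        sums (cinner (pw n x) y - cinner (pw N x) (pw (N - n) y) + s)"
      using True by (simp add: telescope)
    note 1 = near[OF this]
    have "cmod (cinner ((T ^^ n) (V x)) (V y) - cinner (pw n x) y) =
        cmod ((cinner ((T ^^ n) (V x)) (V y) - (cinner (pw n x) y - cinner (pw N x) (pw (N - n) y) + s))
          + s - cinner (pw N x) (pw (N - n) y))"
      by (simp add: algebra_simps)
    also have "\<dots> \<le> E n * (norm x * norm y) + q ^ N * (norm x * norm y) + q ^ N * (norm x * norm y)"
      by (intro order_trans[OF norm_triangle_ineq4] order_trans[OF norm_triangle_ineq] add_mono 1 s_le NN)
    finally show ?thesis using True by (simp add: algebra_simps)
  next
    case False
    then have "(\<lambda>m. \<Sum>l<Suc N - n. \<psi> m (l + n) x * cnj (\<psi> m l y)) sums 0" by simp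
    from near[OF this] have "cmod (cinner ((T ^^ n) (V x)) (V y)) \<le> E n * (norm x * norm y)" by simp
    moreover have "cmod (cinner (pw n x) y) \<le> q ^ n * norm x * norm y"
      using norm_cinner_le[of "pw n x" y] mult_right_mono[OF norm_pw[of n x], of "norm y"] by simp
    ultimately show ?thesis
      using False norm_triangle_ineq4[of "cinner ((T ^^ n) (V x)) (V y)" "cinner (pw n x) y"]
      by (simp add: algebra_simps)
  qed
  then show ?thesis
    using V E unfolding pw_def by blast
qed

end

section \<open>Compressions close to the powers of a contraction\<close>

theorem theorem1p2:
  fixes T :: "'a::chilbert_space \<Rightarrow> 'a"
    and Ct :: "'b::chilbert_space \<Rightarrow> 'b"
    and \<epsilon> :: real
  assumes "bounded_clinear T"
    and "wot_tendsto (\<lambda>n. T ^^ n) (\<lambda>x. 0) sequentially"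
    and "{z. cmod z = 1} \<subseteq> op_spectrum T"
    and "separable_space (euclidean :: 'b topology)"
    and "bounded_clinear Ct"
    and "onorm Ct < 1"
    and "\<epsilon> > 0"
  shows "\<exists>L C. closed_csubspace L \<and> bounded_clinear_on L C \<and>
    unitarily_equivalent_on L C Ct \<and>
    (\<lambda>n. onorm_on L (\<lambda>x. compression L (T ^^ n) x - (C ^^ n) x)) \<longlonglongrightarrow> 0 \<and>
    (SUP n\<in>{1..}. onorm_on L (\<lambda>x. compression L (T ^^ n) x - (C ^^ n) x)) \<le> \<epsilon>"
proof -
  interpret circle_operator T
    using assms by unfold_locales
  note Ct_lin = bounded_clinear_bounded_linear[OF \<open>bounded_clinear Ct\<close>]
  define q where "q = onorm Ct"
  have q: "0 \<le> q" "q < 1" using assms onorm_pos_le[OF Ct_lin] by (simp_all add: q_def)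
  have norm_Ct: "norm (Ct x) \<le> q * norm x" for x
    unfolding q_def by (rule onorm[OF Ct_lin])
  have "\<exists>S. countable S \<and> closure S = (UNIV :: 'b set)"
    using assms(4) unfolding separable_space_def by simp
  then obtain S where S: "countable S" "closure S = (UNIV :: 'b set)" by blast
  have "S \<noteq> {}" using S(2) by auto
  then have "closure (range (from_nat_into S)) = UNIV"
    using S range_from_nat_into by metis
  note dense = this
  have "(\<lambda>n. q ^ n) \<longlonglongrightarrow> 0" using q by (intro LIMSEQ_power_zero) simp
  moreover have "\<epsilon> / 4 > 0" using \<open>\<epsilon> > 0\<close> by simp
  ultimately have "\<forall>\<^sub>F n in sequentially. q ^ n < \<epsilon> / 4"
    by (rule order_tendstoD)
  \<comment> \<open>the truncation at level \<open>N\<close> may cost \<open>2 q\<^sup>N\<close>, which leaves \<open>\<epsilon> / 2\<close> for the errors of the blocks\<close>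
  then obtain N where N: "q ^ N < \<epsilon> / 4"
    unfolding eventually_sequentially by blast
  have \<epsilon>2: "\<epsilon> / 2 > 0" using \<open>\<epsilon> > 0\<close> by simp
  obtain V E where V: "bounded_clinear V" and iso: "\<forall>x y. cinner (V x) (V y) = cinner x y"
    and E: "E \<longlonglongrightarrow> 0" "\<forall>n. 0 \<le> E n \<and> E n \<le> \<epsilon> / 2"
    and VE: "\<forall>n\<ge>1. \<forall>x y. cmod (cinner ((T ^^ n) (V x)) (V y) - cinner ((Ct ^^ n) x) y)
      \<le> (E n + (if n \<le> N then 2 * q ^ N else q ^ n)) * (norm x * norm y)"
    using isometric_model[OF \<open>bounded_clinear Ct\<close> q norm_Ct dense \<epsilon>2, of N] by (elim exE conjE)
  have norm_V: "norm (V x) = norm x" for x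
    unfolding norm_eq_sqrt_cinner using iso by simp
  note lin = linear_simps[OF bounded_clinear_bounded_linear[OF V]]
  define B where "B n = E n + (if n \<le> N then 2 * q ^ N else q ^ n)" for n
  have B_nonneg: "0 \<le> B n" for n
    using E(2) q by (simp add: B_def add_nonneg_nonneg)
  have B_le: "B n \<le> \<epsilon>" for n
  proof -
    have "q ^ n \<le> q ^ N" if "\<not> n \<le> N" using that q by (intro power_decreasing) auto
    moreover have "E n \<le> \<epsilon> / 2" using E(2) by blast
    ultimately show ?thesis
      using N \<open>\<epsilon> > 0\<close> unfolding B_def by (cases "n \<le> N") auto
  qed
  have B_lim: "B \<longlonglongrightarrow> 0"
  proof (rule Lim_transform_eventually)
    show "(\<lambda>n. E n + q ^ n) \<longlonglongrightarrow> 0"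
      using tendsto_add[OF E(1) \<open>(\<lambda>n. q ^ n) \<longlonglongrightarrow> 0\<close>] by simp
    show "\<forall>\<^sub>F n in sequentially. E n + q ^ n = B n"
      using eventually_gt_at_top[of N] by eventually_elim (simp add: B_def)
  qed

  define L where "L = range V"
  define C where "C x = V (Ct (inv V x))" for x
  have L: "closed_csubspace L" unfolding L_def using V norm_V by (rule closed_csubspace_range)
  then have "0 \<in> L" by (simp add: closed_csubspace_def)
  have "inj V"
  proof (rule injI)
    fix x y assume "V x = V y"
    then have "norm (V (x - y)) = 0" by (simp add: lin)
    then show "x = y" by (simp add: norm_V)
  qed
  then have CV: "C (V x) = V (Ct x)" for x by (simp add: C_def)
  have CV_pow: "(C ^^ n) (V x) = V ((Ct ^^ n) x)" for n x
    by (induction n) (simp_all add: CV)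
  have bd: "norm (compression L (T ^^ n) x - (C ^^ n) x) \<le> B n * norm x" if "n \<ge> 1" "x \<in> L" for n x
  proof -
    obtain u where u: "x = V u" using \<open>x \<in> L\<close> by (auto simp: L_def)
    define p where "p = orth_proj L ((T ^^ n) x)"
    define d where "d = p - (C ^^ n) x"
    have "(C ^^ n) x \<in> L" by (simp add: u CV_pow L_def)
    then have "d \<in> L"
      unfolding d_def p_def by (intro closed_csubspace_diff L orth_proj_in)
    then obtain v where v: "d = V v" by (auto simp: L_def)
    have "cinner d d = cinner p d - cinner ((C ^^ n) x) d"
      unfolding cinner.diff_left[symmetric] d_def[symmetric] ..
    also have "cinner p d = cinner ((T ^^ n) (V u)) (V v)"
      using orth_proj_orthogonal[OF L \<open>d \<in> L\<close>, of "(T ^^ n) x"]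
      unfolding p_def cinner.diff_left u v by simp
    also have "cinner ((C ^^ n) x) d = cinner ((Ct ^^ n) u) v"
      unfolding u CV_pow v by (rule iso[rule_format])
    finally have "cmod (cinner d d) \<le> B n * (norm u * norm v)"
      using VE \<open>n \<ge> 1\<close> unfolding B_def by simp
    then have "norm d * norm d \<le> (B n * norm x) * norm d"
      by (simp add: cinner_self u v norm_V norm_power power2_eq_square norm_mult)
    then have "norm d \<le> B n * norm x"
      using B_nonneg[of n] by (cases "norm d = 0") (auto simp: mult_le_cancel_right)
    then show ?thesis by (simp add: d_def p_def compression_def)
  qed
  let ?err = "\<lambda>n. onorm_on L (\<lambda>x. compression L (T ^^ n) x - (C ^^ n) x)"
  have err: "0 \<le> ?err n" "?err n \<le> B n" if "n \<ge> 1" for n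
    using onorm_on_nonneg[OF \<open>0 \<in> L\<close> bd[OF that] B_nonneg] onorm_on_le[OF \<open>0 \<in> L\<close> bd[OF that] B_nonneg]
    by simp_all
  have "?err \<longlonglongrightarrow> 0"
  proof (rule tendsto_sandwich[OF _ _ tendsto_const B_lim])
    show "\<forall>\<^sub>F n in sequentially. 0 \<le> ?err n" "\<forall>\<^sub>F n in sequentially. ?err n \<le> B n"
      using eventually_ge_at_top[of 1] by (eventually_elim, simp add: err)+
  qed
  moreover have "(SUP n\<in>{1..}. ?err n) \<le> \<epsilon>"
    using err(2) B_le by (intro cSUP_least) (auto intro: order_trans)
  moreover have "bounded_clinear_on L C"
    unfolding bounded_clinear_on_def
  proof (intro conjI ballI allI)
    show "C x \<in> L" for x by (simp add: C_def L_def)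
    show "C (x + y) = C x + C y" if xy: "x \<in> L" "y \<in> L" for x y
    proof -
      obtain u v where "x = V u" "y = V v" using xy unfolding L_def by blast
      then show ?thesis by (simp add: CV linear_simps[OF Ct_lin] flip: lin)
    qed
    show "C (c *\<^sub>C x) = c *\<^sub>C C x" if x: "x \<in> L" for c x
    proof -
      obtain u where "x = V u" using x unfolding L_def by blast
      then show ?thesis
        by (simp add: CV bounded_clinear_scaleC[OF \<open>bounded_clinear Ct\<close>] flip: bounded_clinear_scaleC[OF V])
    qed
    show "\<exists>K. \<forall>x\<in>L. norm (C x) \<le> norm x * K"
      using norm_Ct by (intro exI[of _ q]) (auto simp: L_def CV norm_V mult.commute)
  qed
  moreover have "unitarily_equivalent_on L C Ct"
    unfolding unitarily_equivalent_on_def unitary_onto_def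
    using V iso CV by (intro exI[of _ V]) (simp add: L_def)
  ultimately show ?thesis using L by blast
qed

end
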